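(* Let $\mathcal{A}$ be a non-empty free arrangement in $V=\mathbb{K}^\ell$ ($\mathbb{K}$ a field) with $\exp(\mathcal{A})=\{d_1,\ldots,d_\ell\}$, $d_1\le\cdots\le d_\ell$. Let $H\in\mathcal{A}$, $\mathcal{A}'=\mathcal{A}\setminus\{H\}$ and $\mathcal{A}''=\mathcal{A}^H$, and assume that $\mathcal{A}'$ is also free. Let $\{\varphi_1,\ldots,\varphi_\ell\}$ be a homogeneous basis for $D(\mathcal{A})$ with $\deg\varphi_j=d_j$ for $1\le j\le\ell$. Then there exists some $p$ with $1\le p\le\ell$ such that $\{\varphi_1^H,\ldots,\varphi_\ell^H\}\setminus\{\varphi_p^H\}$ (that is, the family $(\varphi_j^H)_{j\ne p}$) forms a basis for $D(\mathcal{A}'')$.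
   Context: An arrangement is a finite set of linear hyperplanes (codimension-one linear subspaces) in $V=\mathbb{K}^\ell$. Let $S=\mathbb{K}[x_1,\ldots,x_\ell]$ with $x_1,\dots,x_\ell$ a basis of $V^*$; for each hyperplane $H$ fix a linear form $\alpha_H$ with $\ker\alpha_H=H$, and let $Q(\mathcal{A})=\prod_{H\in\mathcal{A}}\alpha_H$. $D(\mathcal{A})=\{\phi\in\mathrm{Der}_{\mathbb{K}}(S):\phi(Q(\mathcal{A}))\in Q(\mathcal{A})S\}$. $\mathcal{A}$ is free if $D(\mathcal{A})$ is a free $S$-module; it then has a homogeneous basis (a derivation $\sum f_i\partial/\partial x_i$ is homogeneous of degree $b$ if each non-zero $f_i$ is homogeneous of degree $b$), and $\exp(\mathcal{A})$ is the multiset of degrees of such a basis. The restriction to $H\in\mathcal{A}$ is the arrangement $\mathcal{A}^H=\{K\cap H:K\in\mathcal{A}\setminus\{H\}\}$ in $H$. With $\overline{S}=S/\alpha_HS$ (the coordinate ring of $H$) and $\phi\in D(\mathcal{A})$, the derivation $\phi^H\in\mathrm{Der}(\overline{S})$ is defined by $\phi^H(f+\alpha_HS)=\phi(f)+\alpha_HS$; it lies in $D(\mathcal{A}^H)$, which is an $\overline{S}$-module. *)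

theory Defs
  imports
    "HOL-Analysis.Cartesian_Space"
    "HOL-Library.Poly_Mapping"
    "HOL-Library.Multiset"
    "HOL-Algebra.Module"
    "HOL-Algebra.QuotRing"
begin

section \<open>Free modules\<close>

text \<open>Basis of an \<open>R\<close>-module as an indexed family; \<open>J\<close> may be infinite, so only
  finite linear combinations occur.\<close>

definition module_basis ::
  "('r, 'x) ring_scheme \<Rightarrow> ('r, 'm, 'y) module_scheme \<Rightarrow> ('j \<Rightarrow> 'm) \<Rightarrow> 'j set \<Rightarrow> bool" where
  "module_basis R M b J \<longleftrightarrow>
     b \<in> J \<rightarrow> carrier M \<and>
     (\<forall>m\<in>carrier M. \<exists>F c. finite F \<and> F \<subseteq> J \<and> c \<in> F \<rightarrow> carrier R \<and>
        m = (\<Oplus>\<^bsub>M\<^esub>j\<in>F. c j \<odot>\<^bsub>M\<^esub> b j)) \<and>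
     (\<forall>F c. finite F \<and> F \<subseteq> J \<and> c \<in> F \<rightarrow> carrier R \<and>
        (\<Oplus>\<^bsub>M\<^esub>j\<in>F. c j \<odot>\<^bsub>M\<^esub> b j) = \<zero>\<^bsub>M\<^esub> \<longrightarrow> (\<forall>j\<in>F. c j = \<zero>\<^bsub>R\<^esub>))"

definition free_module :: "('r, 'x) ring_scheme \<Rightarrow> ('r, 'm, 'y) module_scheme \<Rightarrow> bool" where
  "free_module R M \<longleftrightarrow> (\<exists>B. module_basis R M (\<lambda>b. b) B)"


section \<open>Derivations of a commutative algebra\<close>

text \<open>A \<open>\<bbbK>\<close>-algebra is a ring \<open>R\<close> together with its structure map
  \<open>\<iota> : \<bbbK> \<rightarrow> R\<close>. Derivations are extensional functions, so that equality of
  derivations is equality on the carrier.\<close>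

definition derivations :: "('r, 'x) ring_scheme \<Rightarrow> ('k \<Rightarrow> 'r) \<Rightarrow> ('r \<Rightarrow> 'r) set" where
  "derivations R \<iota> = {\<theta> \<in> carrier R \<rightarrow>\<^sub>E carrier R.
     (\<forall>f\<in>carrier R. \<forall>g\<in>carrier R. \<theta> (f \<oplus>\<^bsub>R\<^esub> g) = \<theta> f \<oplus>\<^bsub>R\<^esub> \<theta> g) \<and>
     (\<forall>c. \<forall>f\<in>carrier R. \<theta> (\<iota> c \<otimes>\<^bsub>R\<^esub> f) = \<iota> c \<otimes>\<^bsub>R\<^esub> \<theta> f) \<and>
     (\<forall>f\<in>carrier R. \<forall>g\<in>carrier R.
        \<theta> (f \<otimes>\<^bsub>R\<^esub> g) = (f \<otimes>\<^bsub>R\<^esub> \<theta> g) \<oplus>\<^bsub>R\<^esub> (g \<otimes>\<^bsub>R\<^esub> \<theta> f))}"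

text \<open>The \<open>R\<close>-module of derivations \<open>\<theta>\<close> with \<open>\<theta>(Q) \<in> Q R\<close>. The fields \<open>mult\<close> and
  \<open>one\<close> of the record carry no meaning for a module.\<close>

definition log_derivations ::
  "('r, 'x) ring_scheme \<Rightarrow> ('k \<Rightarrow> 'r) \<Rightarrow> 'r \<Rightarrow> ('r, 'r \<Rightarrow> 'r) module" where
  "log_derivations R \<iota> Q =
     \<lparr>carrier = {\<theta> \<in> derivations R \<iota>. \<theta> Q \<in> PIdl\<^bsub>R\<^esub> Q},
      mult = undefined, one = undefined,
      zero = (\<lambda>f\<in>carrier R. \<zero>\<^bsub>R\<^esub>),
      add = (\<lambda>\<theta> \<eta>. \<lambda>f\<in>carrier R. \<theta> f \<oplus>\<^bsub>R\<^esub> \<eta> f),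
      smult = (\<lambda>a \<theta>. \<lambda>f\<in>carrier R. a \<otimes>\<^bsub>R\<^esub> \<theta> f)\<rparr>"


section \<open>The polynomial ring of \<open>V\<close>\<close>

text \<open>\<open>V\<close> is \<open>'k ^ 'n\<close>, and \<open>S\<close> is the polynomial ring on the coordinate functions
  \<open>x\<^sub>i\<close>, \<open>i :: 'n\<close>: a polynomial maps each exponent vector to its coefficient.\<close>

type_synonym ('k, 'n) mpoly = "('n \<Rightarrow>\<^sub>0 nat) \<Rightarrow>\<^sub>0 'k"

definition S_ring :: "('k::field, 'n::finite) mpoly ring" where
  "S_ring = \<lparr>carrier = UNIV, mult = (*), one = 1, zero = 0, add = (+)\<rparr>"

definition const :: "'k::field \<Rightarrow> ('k, 'n::finite) mpoly" where
  "const c = Poly_Mapping.single 0 c"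

definition homogeneous :: "nat \<Rightarrow> ('k::field, 'n::finite) mpoly \<Rightarrow> bool" where
  "homogeneous b f \<longleftrightarrow> (\<forall>m\<in>Poly_Mapping.keys f. (\<Sum>i\<in>UNIV. Poly_Mapping.lookup m i) = b)"

definition partial :: "'n \<Rightarrow> ('k::field, 'n::finite) mpoly \<Rightarrow> ('k, 'n) mpoly" where
  "partial i f = (\<Sum>m\<in>Poly_Mapping.keys f.
     Poly_Mapping.single (m - Poly_Mapping.single i 1)
       (of_nat (Poly_Mapping.lookup m i) * Poly_Mapping.lookup f m))"

text \<open>The zero polynomial is \<open>homogeneous b\<close> for every \<open>b\<close>, so the condition below
  only constrains the non-zero coefficients.\<close>

definition homogeneous_derivation ::
  "nat \<Rightarrow> (('k::field, 'n::finite) mpoly \<Rightarrow> ('k, 'n) mpoly) \<Rightarrow> bool" where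
  "homogeneous_derivation b \<theta> \<longleftrightarrow>
     (\<exists>f. \<theta> = (\<lambda>g. \<Sum>i\<in>UNIV. f i * partial i g) \<and> (\<forall>i. homogeneous b (f i)))"


section \<open>Arrangements\<close>

definition hyperplane_in :: "('k::field ^ 'n::finite) set \<Rightarrow> ('k ^ 'n) set \<Rightarrow> bool" where
  "hyperplane_in W X \<longleftrightarrow> vec.subspace X \<and> X \<subseteq> W \<and> vec.dim X + 1 = vec.dim W"

definition arrangement :: "('k::field ^ 'n::finite) set set \<Rightarrow> bool" where
  "arrangement A \<longleftrightarrow> finite A \<and> (\<forall>H\<in>A. hyperplane_in UNIV H)"

text \<open>A vector \<open>a\<close> stands for the linear form \<open>\<Sum> a\<^sub>i x\<^sub>i\<close>.\<close>

definition form_kernel :: "'k::field ^ 'n::finite \<Rightarrow> ('k ^ 'n) set" where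
  "form_kernel a = {v. (\<Sum>i\<in>UNIV. a $ i * v $ i) = 0}"

definition form_poly :: "'k::field ^ 'n::finite \<Rightarrow> ('k, 'n) mpoly" where
  "form_poly a = (\<Sum>i\<in>UNIV. Poly_Mapping.single (Poly_Mapping.single i 1) (a $ i))"

text \<open>The fixed linear form on the subspace \<open>W\<close> with kernel the hyperplane \<open>X\<close> of \<open>W\<close>,
  given by an extension of that form to \<open>V\<close>. Two extensions differ by a form
  vanishing on \<open>W\<close>, hence agree in the coordinate ring of \<open>W\<close>.\<close>

definition defining_form ::
  "('k::field ^ 'n::finite) set \<Rightarrow> ('k ^ 'n) set \<Rightarrow> ('k, 'n) mpoly" where
  "defining_form W X = form_poly (SOME a. W \<inter> form_kernel a = X)"

definition Q_poly :: "('k::field ^ 'n::finite) set set \<Rightarrow> ('k, 'n) mpoly" where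
  "Q_poly A = (\<Prod>H\<in>A. defining_form UNIV H)"

definition D_module :: "('k::field ^ 'n::finite) set set \<Rightarrow>
    (('k, 'n) mpoly, ('k, 'n) mpoly \<Rightarrow> ('k, 'n) mpoly) module" where
  "D_module A = log_derivations S_ring const (Q_poly A)"

definition free_arrangement :: "('k::field ^ 'n::finite) set set \<Rightarrow> bool" where
  "free_arrangement A \<longleftrightarrow> free_module S_ring (D_module A)"

definition exponents :: "('k::field ^ 'n::finite) set set \<Rightarrow> nat multiset" where
  "exponents A = (THE E. \<exists>(r::nat) \<phi> d.
     module_basis S_ring (D_module A) \<phi> {1..r} \<and>
     (\<forall>j\<in>{1..r}. homogeneous_derivation (d j) (\<phi> j)) \<and>
     E = image_mset d (mset_set {1..r}))"


section \<open>Restriction to a hyperplane\<close>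

definition restriction ::
  "('k::field ^ 'n::finite) set set \<Rightarrow> ('k ^ 'n) set \<Rightarrow> ('k ^ 'n) set set" where
  "restriction A H = (\<lambda>K. K \<inter> H) ` (A - {H})"

definition H_ideal :: "('k::field ^ 'n::finite) set \<Rightarrow> ('k, 'n) mpoly set" where
  "H_ideal H = PIdl\<^bsub>S_ring\<^esub> (defining_form UNIV H)"

definition S_bar :: "('k::field ^ 'n::finite) set \<Rightarrow> ('k, 'n) mpoly set ring" where
  "S_bar H = S_ring Quot (H_ideal H)"

definition to_S_bar ::
  "('k::field ^ 'n::finite) set \<Rightarrow> ('k, 'n) mpoly \<Rightarrow> ('k, 'n) mpoly set" where
  "to_S_bar H f = H_ideal H +>\<^bsub>S_ring\<^esub> f"

text \<open>For an arrangement \<open>B\<close> in the vector space \<open>H\<close>, such as \<open>restriction A H\<close>.\<close>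

definition Q_in ::
  "('k::field ^ 'n::finite) set \<Rightarrow> ('k ^ 'n) set set \<Rightarrow> ('k, 'n) mpoly set" where
  "Q_in H B = (\<Otimes>\<^bsub>S_bar H\<^esub>X\<in>B. to_S_bar H (defining_form H X))"

definition D_module_in :: "('k::field ^ 'n::finite) set \<Rightarrow> ('k ^ 'n) set set \<Rightarrow>
    (('k, 'n) mpoly set, ('k, 'n) mpoly set \<Rightarrow> ('k, 'n) mpoly set) module" where
  "D_module_in H B = log_derivations (S_bar H) (\<lambda>c. to_S_bar H (const c)) (Q_in H B)"

text \<open>\<open>\<theta>\<^sup>H (f + \<alpha>\<^sub>H S) = \<theta> f + \<alpha>\<^sub>H S\<close>, as the union over all representatives \<open>f\<close>
  of the coset; see \<open>restrict_derivation_coset\<close>.\<close>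

definition restrict_derivation :: "('k::field ^ 'n::finite) set \<Rightarrow>
    (('k, 'n) mpoly \<Rightarrow> ('k, 'n) mpoly) \<Rightarrow> ('k, 'n) mpoly set \<Rightarrow> ('k, 'n) mpoly set" where
  "restrict_derivation H \<theta> = (\<lambda>X\<in>carrier (S_bar H). \<Union>f\<in>X. to_S_bar H (\<theta> f))"


section \<open>Basic facts\<close>

lemma S_ring_simps [simp]:
  "carrier S_ring = UNIV" "f \<otimes>\<^bsub>S_ring\<^esub> g = f * g" "\<one>\<^bsub>S_ring\<^esub> = 1"
  "\<zero>\<^bsub>S_ring\<^esub> = 0" "f \<oplus>\<^bsub>S_ring\<^esub> g = f + g"
  by (simp_all add: S_ring_def)

lemma cring_S_ring: "cring S_ring"
  by (intro cringI abelian_groupI comm_monoidI) (auto simp: algebra_simps intro: exI[of _ "- _"])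

lemma H_ideal_iff: "f \<in> H_ideal H \<longleftrightarrow> defining_form UNIV H dvd f"
  by (auto simp: H_ideal_def cgenideal_def dvd_def mult.commute)

lemma ideal_H_ideal: "ideal (H_ideal H) S_ring"
  unfolding H_ideal_def by (rule cring.cgenideal_ideal[OF cring_S_ring]) simp

lemma cring_S_bar: "cring (S_bar H)"
  unfolding S_bar_def by (rule ideal.quotient_is_cring[OF ideal_H_ideal cring_S_ring])

lemma to_S_bar_eq: "to_S_bar H f = {g. g - f \<in> H_ideal H}"
  unfolding to_S_bar_def a_r_coset_def r_coset_def
  by (auto simp: algebra_simps)

lemma carrier_S_bar: "carrier (S_bar H) = range (to_S_bar H)"
  unfolding S_bar_def FactRing_def A_RCOSETS_def RCOSETS_def to_S_bar_def a_r_coset_def by auto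

lemma to_S_bar_eq_iff: "to_S_bar H f = to_S_bar H g \<longleftrightarrow> f - g \<in> H_ideal H"
proof
  assume "to_S_bar H f = to_S_bar H g"
  moreover have "f \<in> to_S_bar H f" by (simp add: to_S_bar_eq H_ideal_iff)
  ultimately show "f - g \<in> H_ideal H" by (simp add: to_S_bar_eq)
next
  assume fg: "f - g \<in> H_ideal H"
  have "h - f \<in> H_ideal H \<longleftrightarrow> h - g \<in> H_ideal H" for h
    using fg dvd_add[of _ "h - f" "f - g"] dvd_diff[of _ "h - g" "f - g"]
    by (auto simp: H_ideal_iff)
  then show "to_S_bar H f = to_S_bar H g" by (simp add: to_S_bar_eq)
qed

lemma restrict_derivation_coset:
  assumes "\<theta> \<in> derivations S_ring const" and "\<theta> ` H_ideal H \<subseteq> H_ideal H"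
  shows "restrict_derivation H \<theta> (to_S_bar H f) = to_S_bar H (\<theta> f)"
proof -
  have add: "\<theta> (g + h) = \<theta> g + \<theta> h" for g h
    using assms(1) by (simp add: derivations_def)
  have "to_S_bar H (\<theta> g) = to_S_bar H (\<theta> f)" if "g \<in> to_S_bar H f" for g
  proof -
    have "\<theta> g - \<theta> f = \<theta> (g - f)" using add[of "g - f" f] by simp
    moreover have "\<theta> (g - f) \<in> H_ideal H" using that assms(2) by (auto simp: to_S_bar_eq)
    ultimately show ?thesis by (simp add: to_S_bar_eq_iff)
  qed
  moreover have "f \<in> to_S_bar H f" by (simp add: to_S_bar_eq H_ideal_iff)
  ultimately have "(\<Union>g\<in>to_S_bar H f. to_S_bar H (\<theta> g)) = to_S_bar H (\<theta> f)" by blast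
  then show ?thesis by (simp add: restrict_derivation_def carrier_S_bar)
qed

end

(* Let alpha be the form of H and write Q = alpha * Q'. Identify a derivation with its vector of
   coefficients and S/alpha S with the polynomials obtained by eliminating one variable x_i of alpha.
   By Saito's determinant argument a basis of D(A) has determinant Q up to a unit, and likewise for
   D(A'). Hence the matrix N expressing alpha D(A') in the basis phi of D(A) has determinant
   alpha^(l-1) up to a unit, which has order l-1 at the origin, so some entry N_qp does not vanish at 0.
   Taking the component of degree d_p gives theta in D(A') with
   alpha theta = sum_j c_j phi_j, where c_p is a non-zero constant.
   So the matrix with rows phi_j (j /= p) and theta has determinant dividing Q'; modulo alpha it factors
   as theta(alpha) * det(phi_j^H). Since theta(alpha) is divisible modulo alpha by
   prod_X beta_X^(n_X - 1), where n_X counts the hyperplanes of A' over X in A'', the determinant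
   det(phi_j^H) divides prod_X beta_X = Q'', and Cramer's rule shows that the phi_j^H (j /= p)
   form a basis of D(A''). *)

theory Submission
  imports Defs "HOL-Analysis.Determinants" "HOL-Computational_Algebra.Factorial_Ring"
begin

section \<open>Polynomials\<close>

text \<open>The index p is the column of an entry of N with non-zero constant term. Passing to
  degree d_p turns that constant term into the entire coefficient c_p, so phi_p can be exchanged for
  theta: the determinant loses one factor alpha and gains only a unit. Saito's criterion is used as
  two separate divisibilities. Any l logarithmic vectors have a determinant divisible by Q; a
  spanning family has a determinant dividing Q. The second is obtained from test matrices: Q times
  the identity gives a divisor of Q^l, and for each form a matrix whose determinant contains that
  form only once excludes squares. Factorization arguments rest on linear forms being prime, which
  comes from elimination: it is a ring endomorphism of S with kernel alpha S. As its image lies in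
  S, all determinants over S/alpha S can be computed in S. Freeness of A' provides a basis with an
  unknown index set. That it has l elements is recovered by comparison with Q times the
  identity.\<close>

abbreviation (input) "single \<equiv> Poly_Mapping.single"
abbreviation (input) "keys \<equiv> Poly_Mapping.keys"
abbreviation (input) "lookup \<equiv> Poly_Mapping.lookup"

definition X :: "'n \<Rightarrow> ('k::field, 'n::finite) mpoly" where
  "X i = single (single i 1) 1"

definition mdeg :: "('n::finite \<Rightarrow>\<^sub>0 nat) \<Rightarrow> nat" where
  "mdeg m = (\<Sum>i\<in>UNIV. lookup m i)"

lemma mdeg_eq_0_iff: "mdeg m = 0 \<longleftrightarrow> m = 0"
  by (auto simp: mdeg_def intro: poly_mapping_eqI)

lemma mdeg_add: "mdeg (m + n) = mdeg m + mdeg n"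
  by (simp add: mdeg_def lookup_add sum.distrib)

lemma homogeneous_iff: "homogeneous d f \<longleftrightarrow> (\<forall>m\<in>keys f. mdeg m = d)"
  by (simp add: homogeneous_def mdeg_def)

lemma const_simps [simp]:
  "const 0 = 0" "const 1 = 1" "const (c + d) = const c + const d" "const (c * d) = const c * const d"
  "const (c - d) = const c - const d" "const (- c) = - const c"
  by (simp_all add: const_def single_add mult_single single_diff single_uminus)

lemma lookup_const_0 [simp]: "lookup (const c) 0 = c"
  by (simp add: const_def)

lemma const_eq_0_iff [simp]: "const c = 0 \<longleftrightarrow> c = 0"
  by (metis const_simps(1) lookup_const_0)

lemma const_sum: "const (sum f I) = (\<Sum>i\<in>I. const (f i))"
  by (induction I rule: infinite_finite_induct) auto

lemma const_prod: "const (prod f I) = (\<Prod>i\<in>I. const (f i))"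
  by (induction I rule: infinite_finite_induct) auto

lemma const_inverse: "c \<noteq> 0 \<Longrightarrow> const (inverse c) * const c = 1"
  by (metis const_simps(2,4) left_inverse)

lemma monomial_expansion: "f = (\<Sum>m\<in>keys f. single m (lookup f m))"
  by (rule poly_mapping_eqI) (simp add: lookup_sum lookup_single when_def in_keys_iff)

lemma mpoly_additive_induct [case_names monomial add]:
  assumes "\<And>m c. P (single m c)" and "\<And>f g. P f \<Longrightarrow> P g \<Longrightarrow> P (f + g)"
  shows "P (f :: ('k::field, 'n::finite) mpoly)"
proof -
  have "P (\<Sum>m\<in>F. single m (lookup f m))" if "finite F" for F
    \<comment> \<open>The instance at \<open>0 0\<close> is \<open>P 0\<close>, which serves the
      empty sum.\<close>
    using that by induction (use assms(1)[of 0 0] assms in auto)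
  from this[of "keys f"] show ?thesis by (subst monomial_expansion) simp
qed

lemma X_power: "X i ^ k = single (single i k) 1"
  by (induction k) (simp_all add: X_def mult_single flip: single_add)

lemma prod_X_power: "(\<Prod>i\<in>I. X i ^ f i) = single (\<Sum>i\<in>I. single i (f i)) 1"
  by (induction I rule: infinite_finite_induct) (simp_all add: X_power mult_single)

lemma monomial_eq: "single m c = const c * (\<Prod>i\<in>UNIV. X i ^ lookup m i)"
proof -
  have "(\<Sum>i\<in>UNIV. single i (lookup m i)) = m"
    by (rule poly_mapping_eqI) (simp add: lookup_sum lookup_single when_def)
  then show ?thesis by (simp add: prod_X_power const_def mult_single)
qed

lemma mpoly_induct [case_names const X add mult]:
  assumes const: "\<And>c. P (const c)" and X: "\<And>i. P (X i)"
    and add: "\<And>f g. P f \<Longrightarrow> P g \<Longrightarrow> P (f + g)" and mult: "\<And>f g. P f \<Longrightarrow> P g \<Longrightarrow> P (f * g)"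
  shows "P (f :: ('k::field, 'n::finite) mpoly)"
proof (induction f rule: mpoly_additive_induct)
  case (monomial m c)
  have pow: "P (X i ^ k)" for i k
    by (induction k) (use const[of 1] X mult in auto)
  have "P (\<Prod>i\<in>I. X i ^ lookup m i)" if "finite I" for I :: "'n set"
    using that by induction (use const[of 1] pow mult in auto)
  then show ?case by (simp add: monomial_eq const mult)
qed (rule add)

text \<open>Leading monomials: the product of the two largest monomials cannot cancel. The index
  type carries no order, so exponents are transported to \<open>nat\<close>-indexed ones, whose
  linear order is compatible with addition.\<close>

lemma mpoly_no_zero_divisors:
  fixes f g :: "('k::field, 'n::finite) mpoly"
  assumes "f \<noteq> 0" "g \<noteq> 0"
  shows "f * g \<noteq> 0"
proof -
  obtain e :: "'n \<Rightarrow> nat" where e: "inj e"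
    using finite_imp_inj_to_nat_seg[of "UNIV :: 'n set"] by auto
  define \<rho> where "\<rho> m = (\<Sum>i\<in>UNIV. single (e i) (lookup m i))" for m :: "'n \<Rightarrow>\<^sub>0 nat"
  have \<rho>_lookup: "lookup (\<rho> m) (e i) = lookup m i" for m i
    using e by (simp add: \<rho>_def lookup_sum lookup_single when_def inj_eq)
  have \<rho>_inj: "m = n" if "\<rho> m = \<rho> n" for m n
    by (rule poly_mapping_eqI) (metis \<rho>_lookup that)
  have \<rho>_add: "\<rho> (m + n) = \<rho> m + \<rho> n" for m n
    by (simp add: \<rho>_def lookup_add single_add sum.distrib)
  have top: "\<exists>a\<in>keys h. \<forall>m\<in>keys h. \<rho> m \<le> \<rho> a" if "h \<noteq> 0" for h :: "('k, 'n) mpoly"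
  proof -
    have "Max (\<rho> ` keys h) \<in> \<rho> ` keys h" using that by (intro Max_in) auto
    then obtain a where "a \<in> keys h" "\<rho> a = Max (\<rho> ` keys h)" by auto
    then show ?thesis by (metis Max_ge finite_imageI finite_keys imageI)
  qed
  obtain a where a: "a \<in> keys f" "\<And>m. m \<in> keys f \<Longrightarrow> \<rho> m \<le> \<rho> a" using top[OF assms(1)] by auto
  obtain b where b: "b \<in> keys g" "\<And>m. m \<in> keys g \<Longrightarrow> \<rho> m \<le> \<rho> b" using top[OF assms(2)] by auto
  \<comment> \<open>Maximality of both \<open>a\<close> and \<open>b\<close> leaves only one way to
    reach their sum.\<close>
  have uniq: "m + n = a + b \<longleftrightarrow> m = a \<and> n = b" if "m \<in> keys f" "n \<in> keys g" for m n
  proof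
    assume "m + n = a + b"
    then have eq: "\<rho> m + \<rho> n = \<rho> a + \<rho> b" by (metis \<rho>_add)
    have "\<rho> m \<le> \<rho> a" "\<rho> n \<le> \<rho> b" using a b that by auto
    then have "\<rho> m = \<rho> a" "\<rho> n = \<rho> b" using eq
      by (metis add_le_cancel_left add_le_cancel_right antisym)+
    then show "m = a \<and> n = b" using \<rho>_inj by blast
  qed auto
  have "f * g = (\<Sum>m\<in>keys f. \<Sum>n\<in>keys g. single (m + n) (lookup f m * lookup g n))"
    by (subst (1 2) monomial_expansion) (simp add: sum_product mult_single)
  then have "lookup (f * g) (a + b) =
      (\<Sum>m\<in>keys f. \<Sum>n\<in>keys g. if m + n = a + b then lookup f m * lookup g n else 0)"
    by (simp add: lookup_sum lookup_single when_def)
  also have "\<dots> = (\<Sum>m\<in>keys f. \<Sum>n\<in>keys g. if n = b then (if m = a then lookup f m * lookup g n else 0) else 0)"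
    by (intro sum.cong refl) (use uniq in auto)
  also have "\<dots> = lookup f a * lookup g b"
    using a(1) b(1) by simp
  finally show ?thesis using a(1) b(1) by (auto simp: in_keys_iff)
qed

lemma mpoly_mult_eq_0_iff [simp]:
  "f * g = 0 \<longleftrightarrow> f = 0 \<or> g = (0 :: ('k::field, 'n::finite) mpoly)"
  using mpoly_no_zero_divisors by auto

lemma mpoly_mult_cancel:
  "h \<noteq> 0 \<Longrightarrow> h * f = h * g \<longleftrightarrow> f = (g :: ('k::field, 'n::finite) mpoly)"
  by (metis mpoly_mult_eq_0_iff right_diff_distrib eq_iff_diff_eq_0)

lemma mpoly_dvd_mult_cancel:
  "h \<noteq> 0 \<Longrightarrow> h * f dvd h * g \<longleftrightarrow> f dvd (g :: ('k::field, 'n::finite) mpoly)"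
  by (auto simp: dvd_def mult.assoc mpoly_mult_cancel)

lemma mpoly_prod_eq_0_iff:
  "finite I \<Longrightarrow> prod f I = 0 \<longleftrightarrow> (\<exists>i\<in>I. f i = (0 :: ('k::field, 'n::finite) mpoly))"
  by (induction I rule: finite_induct) auto

lemma mpoly_power_eq_0_iff:
  "f ^ n = 0 \<longleftrightarrow> 0 < n \<and> f = (0 :: ('k::field, 'n::finite) mpoly)"
  by (induction n) auto

section \<open>Substitution of polynomials for the variables\<close>

definition subst :: "('n \<Rightarrow> ('k::field, 'n::finite) mpoly) \<Rightarrow> ('k, 'n) mpoly \<Rightarrow> ('k, 'n) mpoly" where
  "subst u f = (\<Sum>m\<in>keys f. const (lookup f m) * (\<Prod>i\<in>UNIV. u i ^ lookup m i))"

lemma subst_add [simp]: "subst u (f + g) = subst u f + subst u g"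
  unfolding subst_def by (rule setsum_keys_plus_distrib) (simp_all add: algebra_simps)

lemma subst_single: "subst u (single m c) = const c * (\<Prod>i\<in>UNIV. u i ^ lookup m i)"
  by (simp add: subst_def)

lemma subst_mult [simp]: "subst u (f * g) = subst u f * subst u g"
proof (induction f rule: mpoly_additive_induct)
  case (monomial m c)
  show ?case
    by (induction g rule: mpoly_additive_induct)
      (simp_all add: mult_single subst_single lookup_add power_add prod.distrib algebra_simps)
qed (simp add: distrib_right)

lemma subst_const [simp]: "subst u (const c) = const c"
  unfolding const_def subst_single by (simp add: const_def)

lemma subst_X [simp]: "subst u (X i) = u i"
proof -
  have "(\<Prod>j\<in>UNIV. u j ^ lookup (single i 1) j) = (\<Prod>j\<in>UNIV. if j = i then u i else 1)"
    by (rule prod.cong) (auto simp: lookup_single)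
  then show ?thesis by (simp add: X_def subst_single)
qed

lemma subst_simps [simp]: "subst u 0 = 0" "subst u 1 = 1"
  using subst_const[of u 0] subst_const[of u 1] by simp_all

lemma subst_uminus [simp]: "subst u (- f) = - subst u f"
  using subst_add[of u f "- f"] by (simp add: eq_neg_iff_add_eq_0 add.commute)

lemma subst_diff [simp]: "subst u (f - g) = subst u f - subst u g"
  using subst_add[of u f "- g"] by simp

lemma subst_sum [simp]: "subst u (sum f I) = (\<Sum>i\<in>I. subst u (f i))"
  by (induction I rule: infinite_finite_induct) auto

lemma subst_prod [simp]: "subst u (prod f I) = (\<Prod>i\<in>I. subst u (f i))"
  by (induction I rule: infinite_finite_induct) auto

section \<open>Partial derivatives\<close>

lemma partial_add [simp]: "partial i (f + g) = partial i f + partial i g"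
  unfolding partial_def by (rule setsum_keys_plus_distrib) (simp_all add: algebra_simps single_add)

lemma partial_single: "partial i (single m c) = single (m - single i 1) (of_nat (lookup m i) * c)"
  by (simp add: partial_def)

text \<open>Subtraction of exponents truncates at 0; a positive exponent of \<open>i\<close> is what
  lets it commute with the addition of \<open>n\<close>.\<close>

lemma add_monomial_diff:
  "lookup m i \<noteq> 0 \<Longrightarrow> n + (m - single i 1) = n + m - single i (1::nat)"
  by (rule poly_mapping_eqI) (auto simp: lookup_add lookup_minus lookup_single when_def)

lemma partial_mult: "partial i (f * g) = f * partial i g + g * partial i f"
proof (induction f rule: mpoly_additive_induct)
  case (monomial m c)
  show ?case
  proof (induction g rule: mpoly_additive_induct)
    case (monomial n d)
    show ?case
      \<comment> \<open>If \<open>i\<close> does not occur in a monomial, the truncated exponent is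
        harmless because its coefficient is 0.\<close>
      using add_monomial_diff[of m i n] add_monomial_diff[of n i m]
      by (cases "lookup m i = 0"; cases "lookup n i = 0")
        (simp_all add: mult_single partial_single lookup_add algebra_simps flip: single_add)
  qed (simp add: distrib_left distrib_right)
qed (simp add: distrib_left distrib_right)

lemma partial_const [simp]: "partial i (const c) = 0"
  by (simp add: const_def partial_single)

lemma partial_X: "partial i (X j) = (if i = j then 1 else 0)"
  by (auto simp: X_def partial_single lookup_single)

section \<open>Graded components and order of vanishing at the origin\<close>

definition component :: "nat \<Rightarrow> ('k::field, 'n::finite) mpoly \<Rightarrow> ('k, 'n) mpoly" where
  "component k f = (\<Sum>m\<in>keys f. if mdeg m = k then single m (lookup f m) else 0)"

lemma component_add [simp]: "component k (f + g) = component k f + component k g"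
  unfolding component_def by (rule setsum_keys_plus_distrib) (simp_all add: single_add)

lemma component_0 [simp]: "component k 0 = 0"
  by (simp add: component_def)

lemma component_sum [simp]: "component k (sum f I) = (\<Sum>i\<in>I. component k (f i))"
  by (induction I rule: infinite_finite_induct) auto

lemma component_single: "component k (single m c) = (if mdeg m = k then single m c else 0)"
  by (simp add: component_def)

lemma component_degree_0: "component 0 f = const (lookup f 0)"
proof -
  show ?thesis
    by (induction f rule: mpoly_additive_induct)
      (auto simp: mdeg_eq_0_iff component_single const_def lookup_single lookup_add single_add when_def)
qed

text \<open>Multiplication by a homogeneous polynomial shifts degrees; the case distinction guards
  the truncated subtraction \<open>k - d\<close>.\<close>

lemma component_mult_homogeneous:
  assumes "homogeneous d g"
  shows "component k (f * g) = (if d \<le> k then component (k - d) f * g else 0)"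
proof (induction f rule: mpoly_additive_induct)
  case (monomial m c)
  have "component k (single m c * single n (lookup g n)) =
      (if d \<le> k then component (k - d) (single m c) * single n (lookup g n) else 0)" if "n \<in> keys g" for n
    using assms that by (auto simp: mult_single component_single mdeg_add homogeneous_iff)
  then have "component k (single m c * (\<Sum>n\<in>keys g. single n (lookup g n))) =
      (if d \<le> k then component (k - d) (single m c) * (\<Sum>n\<in>keys g. single n (lookup g n)) else 0)"
    by (simp add: sum_distrib_left)
  then show ?case by (simp flip: monomial_expansion)
qed (simp add: distrib_right)

text \<open>Membership in the k-th power of the ideal of the origin; the zero polynomial has every
  order.\<close>

definition order_ge :: "nat \<Rightarrow> ('k::field, 'n::finite) mpoly \<Rightarrow> bool" where
  "order_ge k f \<longleftrightarrow> (\<forall>m\<in>keys f. k \<le> mdeg m)"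

lemma order_ge_0 [simp]: "order_ge k 0" "order_ge 0 f"
  by (simp_all add: order_ge_def)

lemma order_ge_mult: "order_ge j f \<Longrightarrow> order_ge k g \<Longrightarrow> order_ge (j + k) (f * g)"
  using keys_mult[of f g] by (fastforce simp: order_ge_def mdeg_add intro: add_mono)

lemma order_ge_sum: "(\<And>i. i \<in> I \<Longrightarrow> order_ge k (f i)) \<Longrightarrow> order_ge k (sum f I)"
  using keys_sum[of f I] by (fastforce simp: order_ge_def)

lemma order_ge_prod:
  "finite I \<Longrightarrow> (\<And>i. i \<in> I \<Longrightarrow> order_ge 1 (f i)) \<Longrightarrow> order_ge (card I) (prod f I)"
  by (induction I rule: finite_induct) (use order_ge_mult[of 1] in auto)

lemma order_ge_1_iff: "order_ge 1 f \<longleftrightarrow> lookup f 0 = 0"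
proof -
  have "1 \<le> mdeg m \<longleftrightarrow> m \<noteq> 0" for m :: "'a \<Rightarrow>\<^sub>0 nat"
    by (metis mdeg_eq_0_iff less_one not_le)
  then show ?thesis by (auto simp: order_ge_def in_keys_iff)
qed

lemma homogeneous_mult: "homogeneous j f \<Longrightarrow> homogeneous k g \<Longrightarrow> homogeneous (j + k) (f * g)"
  using keys_mult[of f g] by (fastforce simp: homogeneous_iff mdeg_add)

lemma homogeneous_power: "homogeneous d f \<Longrightarrow> homogeneous (n * d) (f ^ n)"
proof (induction n)
  case 0
  show ?case by (simp add: homogeneous_def)
next
  case (Suc n)
  then show ?case using homogeneous_mult[of d f "n * d" "f ^ n"] by simp
qed

lemma order_ge_homogeneous: "homogeneous d f \<Longrightarrow> order_ge k f \<Longrightarrow> f \<noteq> 0 \<Longrightarrow> k \<le> d"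
  using keys_eq_empty[of f] by (fastforce simp: homogeneous_iff order_ge_def)


section \<open>Determinants and prime factors\<close>

text \<open>Stands in for triangular matrices, as the index type carries no order: every permutation
  other than \<open>id\<close> meets a zero entry.\<close>

lemma det_eq_prod_diagonal:
  fixes A :: "'a::comm_ring_1^'n^'n"
  assumes "\<And>p. p permutes UNIV \<Longrightarrow> p \<noteq> id \<Longrightarrow> \<exists>i. A$i$p i = 0"
  shows "det A = (\<Prod>i\<in>UNIV. A$i$i)"
proof -
  have "det A = (\<Sum>p\<in>{id}. of_int (sign p) * (\<Prod>i\<in>UNIV. A$i$p i))"
    unfolding det_def
  proof (rule sum.mono_neutral_right)
    show "\<forall>p\<in>{p. p permutes UNIV} - {id}. of_int (sign p) * (\<Prod>i\<in>UNIV. A$i$p i) = 0"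
    proof
      fix p assume "p \<in> {p. p permutes (UNIV :: 'n set)} - {id}"
      then obtain i where "A$i$p i = 0" using assms by blast
      then have "(\<Prod>i\<in>UNIV. A$i$p i) = 0" by (intro prod_zero) auto
      then show "of_int (sign p) * (\<Prod>i\<in>UNIV. A$i$p i) = 0" by simp
    qed
  qed (auto simp: finite_permutations permutes_id)
  then show ?thesis by (simp add: sign_id)
qed

text \<open>Both sides are the cofactor of \<open>A\<close> at (\<open>j\<close>, \<open>m\<close>):
  in either determinant only the permutations with \<open>p j = m\<close> survive, and for them the
  remaining entries coincide.\<close>

lemma det_row_axis_eq_column_axis:
  fixes A :: "'a::comm_ring_1^'n^'n"
  shows "det (\<chi> i. if i = j then axis m 1 else A$i) = det (\<chi> i k. if k = m then axis j 1 $ i else A$i$k)"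
  unfolding det_def
proof (intro sum.cong refl arg_cong2[where f = "(*)"])
  fix p assume "p \<in> {p. p permutes (UNIV :: 'n set)}"
  then have p: "p i = p j \<longleftrightarrow> i = j" for i j by (simp add: permutes_inj inj_eq)
  show "(\<Prod>i\<in>UNIV. (\<chi> i. if i = j then axis m 1 else A$i)$i$p i) =
      (\<Prod>i\<in>UNIV. (\<chi> i k. if k = m then axis j 1 $ i else A$i$k)$i$p i)"
  proof (cases "p j = m")
    case True
    have "p i = m \<longleftrightarrow> i = j" for i using p True by metis
    then show ?thesis by (intro prod.cong) (auto simp: axis_def)
  next
    case False
    obtain l where "p l = m" using \<open>p \<in> _\<close> permutes_surj by (metis mem_Collect_eq surjD)
    then have "(\<chi> i k. if k = m then axis j 1 $ i else A$i$k)$l$p l = 0" using False by (auto simp: axis_def)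
    then have "(\<Prod>i\<in>UNIV. (\<chi> i k. if k = m then axis j 1 $ i else A$i$k)$i$p i) = 0"
      by (intro prod_zero bexI[of _ l]) auto
    moreover have "(\<Prod>i\<in>UNIV. (\<chi> i. if i = j then axis m 1 else A$i)$i$p i) = 0"
      using False by (intro prod_zero bexI[of _ j]) (auto simp: axis_def)
    ultimately show ?thesis by simp
  qed
qed

lemma det_row_sum_smult:
  fixes A :: "'a::comm_ring_1^'n^'n"
  assumes "finite S"
  shows "det (\<chi> i. if i = k then \<Sum>j\<in>S. c j *s g j else A$i) =
      (\<Sum>j\<in>S. c j * det (\<chi> i. if i = k then g j else A$i))"
  using det_linear_row_sum[OF assms, of k "\<lambda>_ j. c j *s g j" "\<lambda>i. A$i"]
  by (simp add: det_row_mul)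

lemma vec_eq_sum_axis: "h = (\<Sum>m\<in>UNIV. h$m *s axis m (1::'a::comm_ring_1))"
  by (simp add: vec_eq_iff axis_def if_distrib cong: if_cong)

text \<open>The adjugate identity, with the numerators of Cramer's rule as coefficients; it involves
  no division and so holds over any commutative ring.\<close>

lemma cramer_rows:
  fixes A :: "'a::comm_ring_1^'n^'n"
  shows "(\<Sum>j\<in>UNIV. det (\<chi> i. if i = j then h else A$i) *s A$j) = det A *s h"
proof -
  \<comment> \<open>Expansion of \<open>det A\<close> along column \<open>m\<close> with the entries
    of column \<open>k\<close> put in; for \<open>k \<noteq> m\<close> the resulting matrix has two
    equal columns.\<close>
  have col: "(\<Sum>j\<in>UNIV. A$j$k * det (\<chi> i. if i = j then axis m 1 else A$i)) =
      (if k = m then det A else 0)" for k m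
  proof -
    let ?T = "transpose A"
    have "det (\<chi> i. if i = j then axis m 1 else A$i) = det (\<chi> l. if l = m then axis j 1 else ?T$l)" for j
    proof -
      have "(\<chi> i k. if k = m then axis j 1 $ i else A$i$k) = transpose (\<chi> l. if l = m then axis j 1 else ?T$l)"
        by (simp add: transpose_def vec_eq_iff)
      then show ?thesis by (simp only: det_row_axis_eq_column_axis det_transpose)
    qed
    then have "(\<Sum>j\<in>UNIV. A$j$k * det (\<chi> i. if i = j then axis m 1 else A$i)) =
        (\<Sum>j\<in>UNIV. ?T$k$j * det (\<chi> l. if l = m then axis j 1 else ?T$l))"
      by (simp add: transpose_def)
    also have "\<dots> = det (\<chi> l. if l = m then ?T$k else ?T$l)"
      by (subst vec_eq_sum_axis[of "?T$k"]) (simp only: det_row_sum_smult[OF finite])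
    also have "\<dots> = (if k = m then det A else 0)"
    proof (cases "k = m")
      case True
      then have "(\<chi> l. if l = m then ?T$k else ?T$l) = ?T" by (simp add: vec_eq_iff)
      then show ?thesis using True by simp
    next
      case False
      then show ?thesis by (auto intro!: det_identical_rows[of k m] simp: row_def)
    qed
    finally show ?thesis .
  qed
  have "det (\<chi> i. if i = j then h else A$i) =
      (\<Sum>m\<in>UNIV. h$m * det (\<chi> i. if i = j then axis m 1 else A$i))" for j
    by (subst vec_eq_sum_axis[of h]) (simp only: det_row_sum_smult[OF finite])
  then have "(\<Sum>j\<in>UNIV. det (\<chi> i. if i = j then h else A$i) * A$j$k) =
      (\<Sum>j\<in>UNIV. \<Sum>m\<in>UNIV. h$m * (A$j$k * det (\<chi> i. if i = j then axis m 1 else A$i)))" for k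
    by (simp add: sum_distrib_left mult_ac)
  also have "\<dots> k = (\<Sum>m\<in>UNIV. \<Sum>j\<in>UNIV. h$m * (A$j$k * det (\<chi> i. if i = j then axis m 1 else A$i)))" for k
    by (rule sum.swap)
  also have "\<dots> k = det A * h$k" for k
    by (simp add: col if_distrib[of "(*) _"] mult.commute cong: if_cong flip: sum_distrib_left)
  finally show ?thesis by (simp add: vec_eq_iff)
qed

lemma det_dvd_column:
  fixes M :: "'a::comm_ring_1^'n^'n"
  assumes "\<And>i. p dvd M$i$k"
  shows "p dvd det M"
  unfolding det_def
proof (rule dvd_sum, rule dvd_mult)
  fix \<pi> assume "\<pi> \<in> {p. p permutes (UNIV :: 'n set)}"
  then obtain l where l: "\<pi> l = k" by (metis mem_Collect_eq permutes_surj surjD)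
  then have "p dvd M$l$\<pi> l" using assms by simp
  then show "p dvd (\<Prod>i\<in>UNIV. M$i$\<pi> i)" by (rule dvd_trans) (rule dvd_prodI[where f = "\<lambda>i. M$i$\<pi> i"]; simp)
qed

lemma det_eq_0_if_zero_column:
  fixes M :: "'a::comm_ring_1^'n^'n"
  assumes "\<And>i. M$i$k = 0"
  shows "det M = 0"
  using det_dvd_column[of 0 M k] assms by simp

lemma rows_matrix_mult: "(A ** B)$i = (\<Sum>k\<in>UNIV. A$i$k *s B$k)" for A B :: "'a::comm_ring_1^'n^'n"
  by (simp add: vec_eq_iff matrix_matrix_mult_def)

text \<open>Multilinearity, one row at a time: expanding a row into its combination leaves a
  non-zero summand, whose vector replaces the row.\<close>

lemma exists_det_ne_0_of_row_combinations:
  fixes E :: "'a::comm_ring_1^'n^'n"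
  assumes "finite F" and "det E \<noteq> 0" and "\<And>r. E$r = (\<Sum>j\<in>F. c r j *s g j)"
  shows "\<exists>f. (\<forall>r. f r \<in> F) \<and> det (\<chi> r. g (f r)) \<noteq> 0"
proof -
  have "\<exists>f. (\<forall>r\<in>T. f r \<in> F) \<and> det (\<chi> r. if r \<in> T then g (f r) else E$r) \<noteq> 0" if "finite T" for T
    using that
  proof induction
    case empty
    then show ?case using assms(2) by simp
  next
    case (insert t T)
    then obtain f where f: "\<forall>r\<in>T. f r \<in> F" and ne: "det (\<chi> r. if r \<in> T then g (f r) else E$r) \<noteq> 0"
      by blast
    let ?M = "\<chi> r. if r \<in> T then g (f r) else E$r"
    have "?M = (\<chi> r. if r = t then \<Sum>j\<in>F. c t j *s g j else ?M$r)"
      using insert.hyps assms(3) by (auto simp: vec_eq_iff)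
    then have "det ?M = (\<Sum>j\<in>F. c t j * det (\<chi> r. if r = t then g j else ?M$r))"
      using det_row_sum_smult[OF assms(1), of t "c t" g ?M] by metis
    then obtain j where j: "j \<in> F" "det (\<chi> r. if r = t then g j else ?M$r) \<noteq> 0"
      using ne by (metis (no_types, lifting) mult_zero_right sum.neutral)
    have "(\<chi> r. if r = t then g j else ?M$r) =
        (\<chi> r. if r \<in> insert t T then g ((f(t := j)) r) else E$r)"
      using insert.hyps by (auto simp: vec_eq_iff)
    then show ?case using f j by (intro exI[of _ "f(t := j)"]) auto
  qed
  from this[of UNIV] show ?thesis by auto
qed

text \<open>Freeness only provides some index set \<open>J\<close>; it turns out to have as many
  elements as there are variables. The nonsingular \<open>E\<close> supplies independent vectors
  \<open>g (\<kappa> r)\<close>, and Cramer's rule makes any further basis vector dependent on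
  them.\<close>

lemma basis_bij_betw:
  fixes g :: "'j \<Rightarrow> ('k::field, 'n::finite) mpoly ^ 'n"
  assumes J: "\<And>j. j \<in> J \<Longrightarrow> g j \<in> L"
    and span: "\<And>h. h \<in> L \<Longrightarrow> \<exists>F c. finite F \<and> F \<subseteq> J \<and> h = (\<Sum>j\<in>F. c j *s g j)"
    and indep: "\<And>F c j. finite F \<Longrightarrow> F \<subseteq> J \<Longrightarrow> (\<Sum>j\<in>F. c j *s g j) = 0 \<Longrightarrow> j \<in> F \<Longrightarrow> c j = 0"
    and E: "det E \<noteq> 0" "\<And>r. E$r \<in> L"
  obtains \<kappa> where "bij_betw \<kappa> UNIV J" "det (\<chi> r. g (\<kappa> r)) \<noteq> 0"
    "\<And>h. h \<in> L \<Longrightarrow> \<exists>c. h = (\<Sum>r\<in>UNIV. c r *s g (\<kappa> r))"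
proof -
  have "\<forall>r. \<exists>F c. finite F \<and> F \<subseteq> J \<and> E$r = (\<Sum>j\<in>F. c j *s g j)"
    using span E(2) by blast
  then obtain F c where F: "\<And>r. finite (F r)" "\<And>r. F r \<subseteq> J"
    and c: "\<And>r. E$r = (\<Sum>j\<in>F r. c r j *s g j)" by metis
  \<comment> \<open>Coefficients are padded with 0 so that all rows use one finite index
    set.\<close>
  have "E$r = (\<Sum>j\<in>(\<Union>r. F r). (if j \<in> F r then c r j else 0) *s g j)" for r
    unfolding c using F by (intro sum.mono_neutral_cong_left) auto
  moreover have "finite (\<Union>r. F r)" using F by simp
  ultimately obtain \<kappa> where \<kappa>: "\<And>r. \<kappa> r \<in> (\<Union>r. F r)" and ne: "det (\<chi> r. g (\<kappa> r)) \<noteq> 0"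
    using exists_det_ne_0_of_row_combinations[of "\<Union>r. F r" E "\<lambda>r j. if j \<in> F r then c r j else 0" g] E(1)
    by blast
  let ?A = "\<chi> r. g (\<kappa> r)"
  have \<kappa>J: "\<kappa> r \<in> J" for r using \<kappa> F by blast
  have inj: "inj \<kappa>"
  proof (rule injI, rule ccontr)
    fix r s assume "\<kappa> r = \<kappa> s" "r \<noteq> s"
    then have "det ?A = 0" by (intro det_identical_rows[of r s]) (simp_all add: row_def)
    then show False using ne by simp
  qed
  have "b \<in> range \<kappa>" if "b \<in> J" for b
  proof (rule ccontr)
    assume b: "b \<notin> range \<kappa>"
    \<comment> \<open>Cramer's relation between \<open>g b\<close> and the chosen rows, moved to one
      side; its coefficient at \<open>b\<close> is the non-zero \<open>- det ?A\<close>.\<close>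
    define c where "c j = (if j = b then - det ?A else
      det (\<chi> i. if i = inv_into UNIV \<kappa> j then g b else ?A$i))" for j
    have "(\<Sum>j\<in>range \<kappa>. c j *s g j) = (\<Sum>r\<in>UNIV. c (\<kappa> r) *s g (\<kappa> r))"
      using inj by (simp add: sum.reindex)
    also have "\<dots> = (\<Sum>r\<in>UNIV. det (\<chi> i. if i = r then g b else ?A$i) *s ?A$r)"
      using b inj by (intro sum.cong) (auto simp: c_def)
    also have "\<dots> = det ?A *s g b" by (rule cramer_rows)
    finally have "(\<Sum>j\<in>insert b (range \<kappa>). c j *s g j) = 0"
      using b by (simp add: c_def vec_eq_iff)
    then have "c b = 0" using that \<kappa>J by (intro indep[of "insert b (range \<kappa>)"]) auto
    then show False using ne by (simp add: c_def)
  qed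
  then have bij: "bij_betw \<kappa> UNIV J" using inj \<kappa>J by (auto simp: bij_betw_def)
  moreover have "\<exists>c. h = (\<Sum>r\<in>UNIV. c r *s g (\<kappa> r))" if h: "h \<in> L" for h
  proof -
    obtain F c where F: "finite F" "F \<subseteq> J" "h = (\<Sum>j\<in>F. c j *s g j)" using span[OF h] by (elim exE conjE)
    have "finite J" using bij by (metis bij_betw_finite finite)
    then have "h = (\<Sum>j\<in>J. (if j \<in> F then c j else 0) *s g j)"
      unfolding F(3) using F by (intro sum.mono_neutral_cong_left) auto
    also have "\<dots> = (\<Sum>r\<in>UNIV. (if \<kappa> r \<in> F then c (\<kappa> r) else 0) *s g (\<kappa> r))"
      using bij by (simp add: sum.reindex_bij_betw[symmetric])
    finally show ?thesis by (rule exI[of _ "\<lambda>r. if \<kappa> r \<in> F then c (\<kappa> r) else 0"])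
  qed
  ultimately show ?thesis using ne that by blast
qed

lemma subst_det: "subst u (det M) = det (\<chi> i j. subst u (M$i$j))"
proof -
  have "subst u (of_int z) = of_int z" for z :: int
    using subst_const[of u "of_int z"] by (simp add: const_def)
  then show ?thesis by (simp add: det_def)
qed

lemma order_ge_det:
  fixes N :: "('k::field, 'n::finite) mpoly ^ 'n ^ 'n"
  assumes "\<And>i j. lookup (N$i$j) 0 = 0"
  shows "order_ge CARD('n) (det N)"
  unfolding det_def
proof (rule order_ge_sum)
  fix p
  have "order_ge CARD('n) (\<Prod>i\<in>UNIV. N$i$p i)"
    using order_ge_prod[of UNIV "\<lambda>i. N$i$p i"] assms order_ge_1_iff by auto
  then show "order_ge CARD('n) (of_int (sign p) * (\<Prod>i\<in>UNIV. N$i$p i))"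
    using order_ge_mult[of 0] by fastforce
qed

section \<open>Divisibility by products of distinct primes\<close>

lemma prime_power_dvd_cancel:
  fixes p :: "('k::field, 'n::finite) mpoly"
  assumes "prime_elem p" "\<not> p dvd x" "p ^ n dvd x * h"
  shows "p ^ n dvd h"
  using assms(3)
proof (induction n arbitrary: h)
  case (Suc n)
  have "p dvd x * h" using Suc.prems by (metis dvd_mult_left power_Suc)
  then obtain h' where h: "h = p * h'" using assms by (auto simp: prime_elem_dvd_mult_iff elim: dvdE)
  have "p * p ^ n dvd p * (x * h')" using Suc.prems by (simp add: h mult.left_commute)
  then have "p ^ n dvd x * h'" 
    by (rule mpoly_dvd_mult_cancel[THEN iffD1, rotated]) (use assms(1) in auto)
  then have "p ^ n dvd h'" by (rule Suc.IH)
  then show ?case unfolding h power_Suc by (rule mult_dvd_mono[OF dvd_refl])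
qed simp

lemma prime_dvd_cancel:
  fixes p :: "('k::field, 'n::finite) mpoly"
  shows "prime_elem p \<Longrightarrow> \<not> p dvd x \<Longrightarrow> p dvd x * h \<Longrightarrow> p dvd h"
  using prime_elem_dvd_multD by blast

lemma prime_dvd_prodD:
  assumes "finite I" "prime_elem p" "p dvd prod f I"
  shows "\<exists>i\<in>I. p dvd (f i :: 'a::comm_semiring_1)"
  using assms(1,3)
proof induction
  case empty
  then show ?case using assms(2) prime_elem_not_unit by auto
qed (auto simp: prime_elem_dvd_mult_iff[OF assms(2)])

text \<open>Induction over \<open>I\<close>: the new prime divides none of the old ones, hence not
  the product of their powers, so its own power passes to the cofactor \<open>h\<close>.\<close>

lemma prod_prime_powers_dvd:
  fixes p :: "'i \<Rightarrow> ('k::field, 'n::finite) mpoly"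
  assumes "finite I" and "\<And>i. i \<in> I \<Longrightarrow> prime_elem (p i)"
    and "\<And>i j. i \<in> I \<Longrightarrow> j \<in> I \<Longrightarrow> i \<noteq> j \<Longrightarrow> \<not> p i dvd p j"
    and "\<And>i. i \<in> I \<Longrightarrow> p i ^ e i dvd g"
  shows "(\<Prod>i\<in>I. p i ^ e i) dvd g"
  using assms
proof (induction I)
  case (insert j I)
  then obtain h where h: "g = (\<Prod>i\<in>I. p i ^ e i) * h" by (auto elim: dvdE)
  have j: "prime_elem (p j)" using insert.prems by simp
  have "\<not> p j dvd (\<Prod>i\<in>I. p i ^ e i)"
  proof
    assume "p j dvd (\<Prod>i\<in>I. p i ^ e i)"
    then obtain i where "i \<in> I" "p j dvd p i ^ e i" using prime_dvd_prodD insert.hyps(1) j by blast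
    then have "p j dvd p i" using j prime_elem_dvd_power by blast
    then show False using insert.prems(2) insert.hyps(2) \<open>i \<in> I\<close> by blast
  qed
  moreover have "p j ^ e j dvd (\<Prod>i\<in>I. p i ^ e i) * h"
    using insert.prems(3)[of j] unfolding h by blast
  ultimately have "p j ^ e j dvd h" by (rule prime_power_dvd_cancel[OF j])
  then show ?case using h insert.hyps by (simp add: mult.commute[of "p j ^ e j"] mult_dvd_mono)
qed simp

lemma prod_primes_dvd:
  fixes p :: "'i \<Rightarrow> ('k::field, 'n::finite) mpoly"
  assumes "finite I" and "\<And>i. i \<in> I \<Longrightarrow> prime_elem (p i)"
    and "\<And>i j. i \<in> I \<Longrightarrow> j \<in> I \<Longrightarrow> i \<noteq> j \<Longrightarrow> \<not> p i dvd p j"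
    and "\<And>i. i \<in> I \<Longrightarrow> p i dvd g"
  shows "prod p I dvd g"
  using prod_prime_powers_dvd[OF assms(1-3), where e = "\<lambda>_. 1" and g = g] assms(4) by simp

lemma dvd_prod_primes_cancel:
  fixes p :: "'i \<Rightarrow> ('k::field, 'n::finite) mpoly"
  assumes "finite I" and "\<And>i. i \<in> I \<Longrightarrow> prime_elem (p i)" and "\<And>i. i \<in> I \<Longrightarrow> \<not> p i dvd e"
    and "e dvd prod p I * x"
  shows "e dvd x"
  using assms
proof (induction I)
  case (insert j I)
  have j: "prime_elem (p j)" using insert.prems by simp
  obtain y where y: "p j * (prod p I * x) = e * y" using insert by (auto simp: mult.assoc elim: dvdE)
  then have "p j dvd e * y" by (metis dvd_triv_left)
  then obtain z where "y = p j * z" using j insert.prems(2)[of j] prime_dvd_cancel by (metis dvdE insertI1)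
  then have "p j * (prod p I * x) = p j * (e * z)" using y by (simp add: mult_ac)
  then have "prod p I * x = e * z" using j by (simp add: mpoly_mult_cancel)
  then show ?case using insert.IH insert.prems by simp
qed simp

text \<open>Split off the primes in \<open>T\<close>, those dividing \<open>d\<close>. One of them
  dividing the cofactor \<open>e\<close> again would give a square in \<open>d\<close>. So no prime
  of the family divides \<open>e\<close>, and since \<open>e\<close> divides a power of their
  product, it is a unit.\<close>

lemma squarefree_dvd_prod_primes:
  fixes p :: "'i \<Rightarrow> ('k::field, 'n::finite) mpoly"
  assumes "finite I" and prime: "\<And>i. i \<in> I \<Longrightarrow> prime_elem (p i)"
    and "\<And>i j. i \<in> I \<Longrightarrow> j \<in> I \<Longrightarrow> i \<noteq> j \<Longrightarrow> \<not> p i dvd p j"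
    and sq: "\<And>i. i \<in> I \<Longrightarrow> \<not> p i * p i dvd d" and pow: "d dvd prod p I ^ N"
  shows "d dvd prod p I"
proof -
  define T where "T = {i\<in>I. p i dvd d}"
  have T: "T \<subseteq> I" "finite T" using assms(1) by (auto simp: T_def)
  have "prod p T dvd d" using assms T by (intro prod_primes_dvd) (auto simp: T_def)
  then obtain e where e: "d = prod p T * e" by (auto elim: dvdE)
  have ndvd: "\<not> p i dvd e" if "i \<in> I" for i
  proof
    assume i: "p i dvd e"
    then have "p i dvd d" by (simp add: e)
    then have "p i dvd prod p T" using that T by (intro dvd_prodI[where f = p]) (auto simp: T_def)
    then show False using i sq[OF that] by (simp add: e mult_dvd_mono)
  qed
  have "e dvd prod p I ^ M \<Longrightarrow> e dvd 1" for M
  proof (induction M)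
    case (Suc M)
    then have "e dvd prod p I * prod p I ^ M" by simp
    then have "e dvd prod p I ^ M" 
      using dvd_prod_primes_cancel[of I p e "prod p I ^ M"] assms(1) prime ndvd by blast
    then show ?case by (rule Suc.IH)
  qed simp
  moreover have "e dvd prod p I ^ N" using pow unfolding e by (rule dvd_mult_right)
  ultimately have "e dvd 1" .
  moreover have "prod p T dvd prod p I" using T assms(1) by (simp add: prod_dvd_prod_subset)
  ultimately have "prod p T * e dvd prod p I * 1" by (intro mult_dvd_mono)
  then show ?thesis by (simp add: e)
qed

text \<open>The sum is the Leibniz expansion of a derivation applied to the product, with
  \<open>h i\<close> its value on \<open>p i\<close>. Modulo \<open>p i\<close> only the summand of
  index \<open>i\<close> can survive, and its cofactor is prime to \<open>p i\<close>.\<close>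

lemma prod_dvd_logarithmic_sum_iff:
  fixes p :: "'i \<Rightarrow> ('k::field, 'n::finite) mpoly"
  assumes "finite I" and prime: "\<And>i. i \<in> I \<Longrightarrow> prime_elem (p i)"
    and coprime: "\<And>i j. i \<in> I \<Longrightarrow> j \<in> I \<Longrightarrow> i \<noteq> j \<Longrightarrow> \<not> p i dvd p j"
  shows "prod p I dvd (\<Sum>i\<in>I. prod p (I - {i}) * h i) \<longleftrightarrow> (\<forall>i\<in>I. p i dvd h i)"
proof
  assume L: "prod p I dvd (\<Sum>i\<in>I. prod p (I - {i}) * h i)"
  show "\<forall>i\<in>I. p i dvd h i"
  proof
    fix i assume i: "i \<in> I"
    have "p i dvd (\<Sum>j\<in>I - {i}. prod p (I - {j}) * h j)"
      using i assms(1) by (intro dvd_sum dvd_mult2 dvd_prodI[where f = p]) auto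
    moreover have "p i dvd (\<Sum>j\<in>I. prod p (I - {j}) * h j)"
      using dvd_trans[OF dvd_prodI[of I i p] L] i assms(1) by simp
    ultimately have "p i dvd prod p (I - {i}) * h i"
      using i assms(1) by (simp add: sum.remove dvd_add_left_iff)
    moreover have "\<not> p i dvd prod p (I - {i})"
    proof
      assume "p i dvd prod p (I - {i})"
      then obtain j where "j \<in> I - {i}" "p i dvd p j"
        using prime_dvd_prodD[of "I - {i}"] assms(1) prime i by blast
      then show False using coprime i by auto
    qed
    ultimately show "p i dvd h i" using prime_dvd_cancel prime i by blast
  qed
next
  assume R: "\<forall>i\<in>I. p i dvd h i"
  show "prod p I dvd (\<Sum>i\<in>I. prod p (I - {i}) * h i)"
  proof (rule dvd_sum)
    fix i assume i: "i \<in> I"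
    then have "prod p I = prod p (I - {i}) * p i"
      using assms(1) by (simp add: prod.remove mult.commute)
    then show "prod p I dvd prod p (I - {i}) * h i" using R i by (simp add: mult_dvd_mono)
  qed
qed


section \<open>Linear forms and logarithmic vectors\<close>

text \<open>The value on the linear form \<open>b\<close> of the derivation with coefficient vector
  \<open>g\<close>; see \<open>derivation_of_form_poly\<close>.\<close>

definition dotp :: "('k::field, 'n::finite) mpoly ^ 'n \<Rightarrow> 'k ^ 'n \<Rightarrow> ('k, 'n) mpoly" where
  "dotp g b = (\<Sum>k\<in>UNIV. const (b$k) * g$k)"

lemma dotp_simps [simp]:
  "dotp (g + h) b = dotp g b + dotp h b" "dotp (f *s g) b = f * dotp g b" "dotp 0 b = 0"
  "dotp g (b + c) = dotp g b + dotp g c" "dotp g (b - c) = dotp g b - dotp g c"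
  "dotp g (t *s b) = const t * dotp g b" "dotp g 0 = 0"
  by (simp_all add: dotp_def algebra_simps sum.distrib sum_subtractf sum_distrib_left)

lemma dotp_sum [simp]: "dotp (sum g I) b = (\<Sum>i\<in>I. dotp (g i) b)"
  by (induction I rule: infinite_finite_induct) auto

lemma dotp_axis [simp]: "dotp g (axis k 1) = g$k" "dotp (axis k 1) b = const (b$k)"
  by (simp_all add: dotp_def axis_def if_distrib[of const] if_distrib[of "\<lambda>x. x * _"]
    if_distrib[of "(*) _"] cong: if_cong)

lemma form_poly_eq_dotp: "form_poly b = dotp (\<chi> k. X k) b"
  by (simp add: form_poly_def dotp_def const_def X_def mult_single)

lemma form_poly_simps [simp]:
  "form_poly (b + c) = form_poly b + form_poly c" "form_poly (b - c) = form_poly b - form_poly c"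
  "form_poly (t *s b) = const t * form_poly b" "form_poly 0 = 0" "form_poly (axis k 1) = X k"
  by (simp_all add: form_poly_eq_dotp)

lemma lookup_form_poly: "lookup (form_poly b) (single k 1) = b$k"
proof -
  have "single i (1::nat) = single k 1 \<longleftrightarrow> i = k" for i
    by (metis lookup_single_eq lookup_single_not_eq zero_neq_one)
  then show ?thesis by (simp add: form_poly_def lookup_sum lookup_single when_def)
qed

lemma form_poly_eq_0_iff [simp]: "form_poly b = 0 \<longleftrightarrow> b = 0"
  by (metis form_poly_simps(4) lookup_form_poly lookup_zero vec_eq_iff zero_index)

lemma homogeneous_form_poly: "homogeneous 1 (form_poly b)"
proof -
  have "mdeg m = 1" if m: "m \<in> keys (form_poly b)" for m
  proof -
    obtain i where "m \<in> keys (single (single i 1) (b$i))"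
      using m keys_sum[of "\<lambda>i. single (single i 1) (b$i)" UNIV] unfolding form_poly_def by blast
    then have "m = single i 1" by (simp split: if_splits)
    then show ?thesis by (simp add: mdeg_def lookup_single when_def)
  qed
  then show ?thesis by (simp add: homogeneous_iff)
qed

section \<open>Elimination of one variable as reduction modulo a linear form\<close>

definition elimv :: "'k::field ^ 'n::finite \<Rightarrow> 'n \<Rightarrow> 'k ^ 'n \<Rightarrow> 'k ^ 'n" where
  "elimv a i b = b - (b$i / a$i) *s a"

text \<open>When \<open>a $ i \<noteq> 0\<close>, only \<open>X i\<close> is changed: it is replaced
  by the solution of \<open>form_poly a = 0\<close> for \<open>X i\<close>. This is a retraction of
  S whose kernel is generated by \<open>form_poly a\<close>, a model of the quotient inside
  S.\<close>

definition elim :: "'k::field ^ 'n::finite \<Rightarrow> 'n \<Rightarrow> ('k, 'n) mpoly \<Rightarrow> ('k, 'n) mpoly" where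
  "elim a i = subst (\<lambda>k. form_poly (elimv a i (axis k 1)))"

lemma elim_simps [simp]:
  "elim a i (f + g) = elim a i f + elim a i g" "elim a i (f * g) = elim a i f * elim a i g"
  "elim a i (f - g) = elim a i f - elim a i g" "elim a i (const c) = const c"
  "elim a i 0 = 0" "elim a i 1 = 1" "elim a i (sum h J) = (\<Sum>j\<in>J. elim a i (h j))"
  "elim a i (prod h J) = (\<Prod>j\<in>J. elim a i (h j))"
  by (simp_all add: elim_def)

lemma elim_dvd: "f dvd g \<Longrightarrow> elim a i f dvd elim a i g"
  by (auto simp: dvd_def)

lemma elimv_simps [simp]: "a$i \<noteq> 0 \<Longrightarrow> elimv a i b $ i = 0"
  by (simp add: elimv_def)

lemma elim_form [simp]: "elim a i (form_poly b) = form_poly (elimv a i b)"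
proof -
  have "elimv a i b = (\<Sum>k\<in>UNIV. b$k *s elimv a i (axis k 1))"
    by (simp add: vec_eq_iff elimv_def axis_def algebra_simps sum_subtractf if_distrib[of "(*) _"]
      if_distrib[of "\<lambda>x. x / _"] cong: if_cong)
  then have "form_poly (elimv a i b) = (\<Sum>k\<in>UNIV. const (b$k) * form_poly (elimv a i (axis k 1)))"
    by (simp add: form_poly_eq_dotp dotp_def const_sum sum_distrib_left sum_distrib_right mult.assoc)
      (rule sum.swap)
  then show ?thesis
    by (subst form_poly_eq_dotp) (simp add: dotp_def elim_def)
qed

lemma form_dvd_diff_elim: "form_poly a dvd f - elim a i f"
proof (induction f rule: mpoly_induct)
  case (X k)
  have "X k - elim a i (X k) = const (axis k 1 $ i / a$i) * form_poly a"
    using elim_form[of a i "axis k 1"] by (simp add: elimv_def)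
  then show ?case by simp
next
  case (add f g)
  have "f + g - elim a i (f + g) = (f - elim a i f) + (g - elim a i g)" by simp
  then show ?case using add by (simp only: dvd_add)
next
  case (mult f g)
  have "f * g - elim a i (f * g) = f * (g - elim a i g) + elim a i g * (f - elim a i f)"
    by (simp add: algebra_simps)
  then show ?case using mult by (simp only: dvd_add dvd_mult)
qed simp

lemma elim_eq_0_iff:
  assumes "a$i \<noteq> 0"
  shows "elim a i f = 0 \<longleftrightarrow> form_poly a dvd f"
proof
  assume "elim a i f = 0"
  then show "form_poly a dvd f" using form_dvd_diff_elim[of a f i] by simp
next
  assume "form_poly a dvd f"
  then have "elim a i (form_poly a) dvd elim a i f" by (rule elim_dvd)
  then show "elim a i f = 0" using assms by (simp add: elimv_def)
qed

lemma elim_eq_iff: "a$i \<noteq> 0 \<Longrightarrow> elim a i f = elim a i g \<longleftrightarrow> form_poly a dvd f - g"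
  using elim_eq_0_iff[of a i "f - g"] by simp

lemma elim_idem: "a$i \<noteq> 0 \<Longrightarrow> elim a i (elim a i f) = elim a i f"
  using form_dvd_diff_elim[of a f i] by (simp add: elim_eq_iff[symmetric])

text \<open>The ideal of \<open>form_poly a\<close> is the kernel of the endomorphism
  \<open>elim a i\<close> of an integral domain.\<close>

lemma prime_elem_form_poly:
  assumes "a \<noteq> 0"
  shows "prime_elem (form_poly a)"
proof -
  obtain i where i: "a$i \<noteq> 0" using assms by (auto simp: vec_eq_iff)
  show ?thesis
    using assms elim_eq_0_iff[OF i, of 1]
    by (intro prime_elemI) (auto simp flip: elim_eq_0_iff[OF i])
qed

lemma form_poly_dvd_form_polyD:
  assumes "form_poly a dvd form_poly b" "a \<noteq> 0"
  shows "\<exists>t. b = t *s a"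
proof -
  obtain i where i: "a$i \<noteq> 0" using assms by (auto simp: vec_eq_iff)
  then have "elimv a i b = 0" using assms(1) elim_eq_0_iff[OF i, of "form_poly b"] by simp
  then show ?thesis by (auto simp: elimv_def)
qed

section \<open>Logarithmic vectors and Saito's determinant criterion\<close>

definition pairwise_nonproportional :: "('i \<Rightarrow> 'k::field ^ 'n) \<Rightarrow> 'i set \<Rightarrow> bool" where
  "pairwise_nonproportional a I \<longleftrightarrow>
     (\<forall>i\<in>I. a i \<noteq> 0) \<and> (\<forall>i\<in>I. \<forall>j\<in>I. i \<noteq> j \<longrightarrow> (\<forall>t. a j \<noteq> t *s a i))"

lemma pairwise_nonproportional_subset:
  "pairwise_nonproportional a I \<Longrightarrow> J \<subseteq> I \<Longrightarrow> pairwise_nonproportional a J"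
  unfolding pairwise_nonproportional_def by blast

lemma pairwise_nonproportional_prime:
  assumes "pairwise_nonproportional a I"
  shows "i \<in> I \<Longrightarrow> prime_elem (form_poly (a i))"
    and "i \<in> I \<Longrightarrow> j \<in> I \<Longrightarrow> i \<noteq> j \<Longrightarrow> \<not> form_poly (a i) dvd form_poly (a j)"
  using assms form_poly_dvd_form_polyD prime_elem_form_poly
  unfolding pairwise_nonproportional_def by blast+

text \<open>D(A) in terms of coefficient vectors, with one condition for each form;
  \<open>carrier_D_module\<close> shows the equivalence with the condition on the product.\<close>

definition log_vectors ::
  "('i \<Rightarrow> 'k::field ^ 'n::finite) \<Rightarrow> 'i set \<Rightarrow> (('k, 'n) mpoly ^ 'n) set" where
  "log_vectors a I = {g. \<forall>i\<in>I. form_poly (a i) dvd dotp g (a i)}"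

text \<open>The coordinate change that replaces \<open>X k\<close> by the form \<open>b\<close>:
  multiplication from the right writes the values of the row derivations on \<open>b\<close> into
  column \<open>k\<close>.\<close>

definition column_op :: "'n \<Rightarrow> 'k::field ^ 'n::finite \<Rightarrow> ('k, 'n) mpoly ^ 'n ^ 'n" where
  "column_op k b = (\<chi> r c. if c = k then const (b$r) else if r = c then 1 else 0)"

lemma det_column_op: "det (column_op k b) = const (b$k)"
proof -
  have "det (column_op k b) = (\<Prod>i\<in>UNIV. column_op k b $ i $ i)"
  proof (rule det_eq_prod_diagonal)
    fix p assume p: "p permutes (UNIV :: 'a set)" "p \<noteq> id"
    show "\<exists>i. column_op k b $ i $ p i = 0"
    proof (cases "p k = k")
      case True
      obtain r where r: "p r \<noteq> r" using p(2) by (auto simp: fun_eq_iff)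
      then have "p r \<noteq> k" using True p(1) by (metis permutes_inj injD)
      then show ?thesis using r by (intro exI[of _ r]) (auto simp: column_op_def)
    next
      case False
      then obtain l where l: "l \<noteq> k" "p k = l" by blast
      then show ?thesis by (intro exI[of _ k]) (simp add: column_op_def)
    qed
  qed
  also have "\<dots> = (\<Prod>i\<in>UNIV. if i = k then const (b$k) else 1)"
    by (rule prod.cong) (auto simp: column_op_def)
  finally show ?thesis by simp
qed

lemma mult_column_op: "(A ** column_op k b)$r$c = (if c = k then dotp (A$r) b else A$r$c)"
  by (simp add: matrix_matrix_mult_def column_op_def dotp_def mult.commute if_distrib[of "(*) _"] cong: if_cong)

text \<open>After the coordinate change column \<open>k\<close> is divisible by \<open>p\<close>,
  and the determinant \<open>const (b$k)\<close> of that change is a unit.\<close>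

lemma dvd_det_if_dvd_dotp:
  assumes "\<And>r. p dvd dotp (A$r) b" "b \<noteq> 0"
  shows "p dvd det A"
proof -
  obtain k where k: "b$k \<noteq> 0" using assms by (auto simp: vec_eq_iff)
  have "p dvd det (A ** column_op k b)"
    using assms by (intro det_dvd_column[of _ _ k]) (simp add: mult_column_op)
  then have "p dvd const (inverse (b$k)) * (const (b$k) * det A)"
    by (simp add: det_mul det_column_op mult.commute)
  then show ?thesis by (simp only: mult.assoc[symmetric] const_inverse[OF k] mult_1_left)
qed

text \<open>The half of Saito's criterion that holds for any square family of logarithmic vectors,
  spanning or not.\<close>

lemma prod_forms_dvd_det:
  assumes "finite I" "pairwise_nonproportional a I" "\<And>r. M$r \<in> log_vectors a I"
  shows "(\<Prod>i\<in>I. form_poly (a i)) dvd det M"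
proof (rule prod_primes_dvd[OF assms(1)])
  fix i assume i: "i \<in> I"
  then show "form_poly (a i) dvd det M"
    using assms(2,3) by (intro dvd_det_if_dvd_dotp) (auto simp: log_vectors_def pairwise_nonproportional_def)
qed (use pairwise_nonproportional_prime[OF assms(2)] in auto)

lemma det_dvd_det_if_spans:
  fixes P :: "('k::field, 'n::finite) mpoly ^ 'n ^ 'n"
  assumes "\<And>h. h \<in> L \<Longrightarrow> \<exists>c. h = (\<Sum>r\<in>UNIV. c r *s P$r)" "\<And>r. E$r \<in> L"
  shows "det P dvd det E"
proof -
  have "\<exists>c. E$r = (\<Sum>s\<in>UNIV. c s *s P$s)" for r by (rule assms(1)[OF assms(2)])
  then obtain c where c: "\<And>r. E$r = (\<Sum>s\<in>UNIV. c r s *s P$s)" by metis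
  have "E = (\<chi> r s. c r s) ** P" by (simp add: vec_eq_iff rows_matrix_mult c)
  then show ?thesis by (simp add: det_mul)
qed

text \<open>The partial derivatives multiplied by the product of all forms are logarithmic for every
  arrangement. They serve twice: as a nonsingular matrix of logarithmic vectors, and to bound a
  determinant by a power of the product.\<close>

lemma scaled_identity:
  fixes a :: "'i \<Rightarrow> 'k::field ^ 'n::finite"
  assumes "finite I"
  defines "E \<equiv> (\<chi> r. (\<Prod>i\<in>I. form_poly (a i)) *s axis r 1) :: ('k, 'n) mpoly ^ 'n ^ 'n"
  shows "E$r \<in> log_vectors a I" "det E = (\<Prod>i\<in>I. form_poly (a i)) ^ CARD('n)"
proof -
  show "E$r \<in> log_vectors a I"
    using assms(1) dvd_prodI[of I _ "\<lambda>i. form_poly (a i)"]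
    by (simp add: E_def log_vectors_def)
  show "det E = (\<Prod>i\<in>I. form_poly (a i)) ^ CARD('n)"
    by (subst det_diagonal) (auto simp: E_def axis_def)
qed

text \<open>The other half of Saito's criterion, by testing spanning rows against explicit
  logarithmic matrices: the scaled identity bounds the determinant by a power of the product, and a
  second matrix for each form shows that this form does not occur twice.\<close>

lemma det_dvd_prod_forms:
  fixes P :: "('k::field, 'n::finite) mpoly ^ 'n ^ 'n"
  assumes "finite I" "pairwise_nonproportional a I"
    and span: "\<And>h. h \<in> log_vectors a I \<Longrightarrow> \<exists>c. h = (\<Sum>r\<in>UNIV. c r *s P$r)"
  shows "det P dvd (\<Prod>i\<in>I. form_poly (a i))"
proof (rule squarefree_dvd_prod_primes[OF assms(1)])
  show "det P dvd (\<Prod>i\<in>I. form_poly (a i)) ^ CARD('n)"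
    unfolding scaled_identity(2)[OF assms(1), symmetric]
    by (rule det_dvd_det_if_spans[where L = "log_vectors a I"]) (rule span, assumption, rule scaled_identity(1)[OF assms(1)])
next
  fix i assume i: "i \<in> I"
  show "\<not> form_poly (a i) * form_poly (a i) dvd det P"
  proof
    assume sq: "form_poly (a i) * form_poly (a i) dvd det P"
    let ?p = "form_poly (a i)"
    define R where "R = (\<Prod>j\<in>I - {i}. form_poly (a j))"
    have p: "prime_elem ?p" using pairwise_nonproportional_prime(1)[OF assms(2) i] .
    obtain k where k: "a i $ k \<noteq> 0"
      using assms(2) i by (auto simp: pairwise_nonproportional_def vec_eq_iff)
    \<comment> \<open>Apart from row \<open>k\<close> the vectors annihilate the form
      \<open>a i\<close>, and the factor \<open>R\<close> takes care of all other forms. The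
      determinant is \<open>?p\<close> times powers of \<open>R\<close> and of the unit
      \<open>const (a i $ k)\<close>, so \<open>?p\<close> occurs exactly once.\<close>
    define E :: "('k, 'n) mpoly ^ 'n ^ 'n" where
      "E = (\<chi> r. if r = k then (R * ?p) *s axis k 1
        else R *s (const (a i $ k) *s axis r 1 - const (a i $ r) *s axis k 1))"
    have "dotp (E$r) (a i) = (if r = k then R * ?p * const (a i $ k) else 0)" for r
      by (simp add: E_def dotp_def axis_def vec_eq_iff algebra_simps sum.distrib sum_subtractf
        if_distrib[of "(*) _"] cong: if_cong)
    then have Ei: "?p dvd dotp (E$r) (a i)" for r by simp
    have "R dvd dotp (E$r) b" for r b
      unfolding E_def by (simp add: mult.assoc)
    then have "form_poly (a j) dvd dotp (E$r) b" if "j \<in> I - {i}" for j r b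
      using dvd_trans[of "form_poly (a j)" R] dvd_prodI[of "I - {i}" j "\<lambda>j. form_poly (a j)"] assms(1) that
      by (auto simp: R_def)
    then have "E$r \<in> log_vectors a I" for r
      using Ei by (auto simp: log_vectors_def)
    then have PE: "det P dvd det E"
      by (intro det_dvd_det_if_spans[where L = "log_vectors a I"] span)
    have "det E = (\<Prod>r\<in>UNIV. E$r$r)"
    proof (rule det_eq_prod_diagonal)
      fix q assume q: "q permutes (UNIV :: 'n set)" "q \<noteq> id"
      show "\<exists>r. E$r$q r = 0"
      proof (cases "q k = k")
        case True
        obtain r where r: "q r \<noteq> r" using q(2) by (auto simp: fun_eq_iff)
        then have "q r \<noteq> k" "r \<noteq> k" using True q(1) by (metis permutes_inj injD)+
        then show ?thesis using r by (intro exI[of _ r]) (auto simp: E_def axis_def)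
      next
        case False
        then show ?thesis by (intro exI[of _ k]) (simp add: E_def axis_def)
      qed
    qed
    also have "\<dots> = E$k$k * (\<Prod>r\<in>UNIV - {k}. E$r$r)"
      by (rule prod.remove) auto
    also have "(\<Prod>r\<in>UNIV - {k}. E$r$r) = (\<Prod>r\<in>UNIV - {k}. R * const (a i $ k))"
      by (rule prod.cong) (auto simp: E_def axis_def)
    also have "E$k$k = ?p * R" by (simp add: E_def)
    finally have "?p * ?p dvd ?p * (R * (\<Prod>r\<in>UNIV - {k}. R * const (a i $ k)))"
      using dvd_trans[OF sq PE] by (simp only: mult.assoc)
    then have "?p dvd R * (\<Prod>r\<in>UNIV - {k}. R * const (a i $ k))"
      using p by (subst (asm) mpoly_dvd_mult_cancel) auto
    moreover have nR: "\<not> ?p dvd R"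
      using prime_dvd_prodD[of "I - {i}" ?p "\<lambda>j. form_poly (a j)"] p assms(1)
        pairwise_nonproportional_prime(2)[OF assms(2) i] by (auto simp: R_def)
    moreover have "\<not> ?p dvd const (a i $ k)"
      using k elim_eq_0_iff[of "a i" k "const (a i $ k)"] by simp
    ultimately show False
      using p prime_dvd_prodD[of "UNIV - {k}" ?p "\<lambda>r. R * const (a i $ k)"]
      by (auto simp: prime_elem_dvd_mult_iff)
  qed
qed (use pairwise_nonproportional_prime[OF assms(2)] in auto)


section \<open>The vectors surviving restriction\<close>

lemma det_row_combination:
  fixes A :: "'a::comm_ring_1^'n^'n"
  assumes "finite S"
  shows "det (\<chi> i. if i = k then \<Sum>j\<in>S. c j *s A$j else A$i) = (if k \<in> S then c k * det A else 0)"
proof -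
  have "det (\<chi> i. if i = k then A$j else A$i) = (if j = k then det A else 0)" for j
  proof (cases "j = k")
    case True
    then have "(\<chi> i. if i = k then A$j else A$i) = A" by (simp add: vec_eq_iff)
    then show ?thesis using True by simp
  next
    case False
    then show ?thesis by (auto intro!: det_identical_rows[of j k] simp: row_def)
  qed
  then show ?thesis
    using assms by (simp add: det_row_sum_smult if_distrib[of "(*) _"] cong: if_cong)
qed

text \<open>The module is graded: pairing with a vector of constants commutes with taking
  components, and the components of a multiple of a linear form are again multiples of it.\<close>

lemma component_log_vector:
  assumes "g \<in> log_vectors a I"
  shows "(\<chi> k. component j (g$k)) \<in> log_vectors a I"
proof -
  have hom: "homogeneous 0 (const c)" for c :: 'b
    by (simp add: homogeneous_def const_def)
  have "dotp (\<chi> k. component j (g$k)) b = component j (dotp g b)" for b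
    by (simp add: dotp_def component_mult_homogeneous[OF hom, where k = j] mult.commute[of "const _"])
  moreover have "form_poly b dvd component j f" if dvd: "form_poly b dvd f" for b f
  proof -
    obtain h where "f = h * form_poly b" using dvd by (metis dvdE mult.commute)
    then show ?thesis using component_mult_homogeneous[OF homogeneous_form_poly, of j h b] by simp
  qed
  ultimately show ?thesis using assms by (auto simp: log_vectors_def)
qed

text \<open>Each half of Saito's criterion points in the direction required: \<open>T\<close> spans,
  so \<open>det T\<close> divides \<open>Q\<close>; \<open>P\<close> is logarithmic, so
  \<open>?\<alpha> * Q\<close> divides \<open>det P\<close>. Hence \<open>det N\<close> divides a
  power of \<alpha> whose degree is one less than the order \<open>det N\<close> would have if all
  entries vanished at 0.\<close>

lemma exists_transition_unit_at_0:
  fixes P T N :: "('k::field, 'n::finite) mpoly ^ 'n ^ 'n"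
  assumes fin: "finite I" and H: "H \<notin> I" and np: "pairwise_nonproportional a (insert H I)"
    and P: "\<And>r. P$r \<in> log_vectors a (insert H I)"
    and spanT: "\<And>h. h \<in> log_vectors a I \<Longrightarrow> \<exists>c. h = (\<Sum>r\<in>UNIV. c r *s T$r)"
    and N: "\<And>q. form_poly (a H) *s T$q = (\<Sum>r\<in>UNIV. N$q$r *s P$r)"
  shows "\<exists>q p. lookup (N$q$p) 0 \<noteq> 0"
proof (rule ccontr)
  assume "\<not> ?thesis"
  then have ord: "order_ge CARD('n) (det N)" by (intro order_ge_det) auto
  let ?\<alpha> = "form_poly (a H)"
  define Q where "Q = (\<Prod>i\<in>I. form_poly (a i))"
  have npI: "pairwise_nonproportional a I"
    using np by (rule pairwise_nonproportional_subset) auto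
  have nz: "?\<alpha> \<noteq> 0" "Q \<noteq> 0"
    using np fin by (auto simp: Q_def mpoly_prod_eq_0_iff pairwise_nonproportional_def)
  have "det T dvd Q" unfolding Q_def by (rule det_dvd_prod_forms[OF fin npI spanT])
  then obtain z where z: "Q = det T * z" by (auto elim: dvdE)
  have "?\<alpha> * Q dvd det P"
    using prod_forms_dvd_det[OF _ np, of P] fin H P by (simp add: Q_def)
  then obtain w where w: "det P = ?\<alpha> * Q * w" by (auto elim: dvdE)
  have "(\<chi> q. ?\<alpha> *s T$q) = N ** P"
    unfolding vec_eq_iff[where 'b = 'n] by (simp add: rows_matrix_mult N)
  then have "?\<alpha> ^ CARD('n) * det T = det N * det P"
    using det_rows_mul[of "\<lambda>_. ?\<alpha>" "\<lambda>q. T$q"] by (simp add: det_mul)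
  \<comment> \<open>Multiplication by \<open>z\<close> completes \<open>det T\<close> to
    \<open>Q\<close>, after which \<open>?\<alpha> * Q\<close> cancels on both sides.\<close>
  then have "?\<alpha> ^ CARD('n) * det T * z = det N * (?\<alpha> * Q * w) * z" by (simp only: w)
  then have "(?\<alpha> * Q) * ?\<alpha> ^ (CARD('n) - 1) = (?\<alpha> * Q) * (z * w * det N)"
    unfolding power_eq_if[of ?\<alpha> "CARD('n)"] by (simp add: z mult_ac)
  then have eq: "?\<alpha> ^ (CARD('n) - 1) = z * w * det N" using nz by (simp add: mpoly_mult_cancel)
  have "order_ge CARD('n) (?\<alpha> ^ (CARD('n) - 1))"
    unfolding eq using order_ge_mult[OF order_ge_0(2) ord] by simp
  then have "CARD('n) \<le> CARD('n) - 1"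
    using order_ge_homogeneous[OF homogeneous_power[OF homogeneous_form_poly[of "a H"], of "CARD('n) - 1"]] nz
    by (simp add: mpoly_power_eq_0_iff)
  then show False using zero_less_card_finite[where 'a = 'n] by linarith
qed

lemma exists_homogeneous_relation:
  fixes P T :: "('k::field, 'n::finite) mpoly ^ 'n ^ 'n"
  assumes fin: "finite I" and H: "H \<notin> I" and np: "pairwise_nonproportional a (insert H I)"
    and P: "\<And>r. P$r \<in> log_vectors a (insert H I)"
    and spanP: "\<And>h. h \<in> log_vectors a (insert H I) \<Longrightarrow> \<exists>c. h = (\<Sum>r\<in>UNIV. c r *s P$r)"
    and hom: "\<And>r k. homogeneous (d r) (P$r$k)"
    and T: "\<And>r. T$r \<in> log_vectors a I"
    and spanT: "\<And>h. h \<in> log_vectors a I \<Longrightarrow> \<exists>c. h = (\<Sum>r\<in>UNIV. c r *s T$r)"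
  shows "\<exists>p c u \<theta>. \<theta> \<in> log_vectors a I \<and> form_poly (a H) *s \<theta> = (\<Sum>r\<in>UNIV. c r *s P$r) \<and>
    c p = const u \<and> u \<noteq> 0"
proof -
  let ?\<alpha> = "form_poly (a H)"
  have "?\<alpha> *s T$q \<in> log_vectors a (insert H I)" for q
    using T[of q] by (auto simp: log_vectors_def)
  then have "\<exists>c. ?\<alpha> *s T$q = (\<Sum>r\<in>UNIV. c r *s P$r)" for q by (rule spanP)
  then obtain c where c: "\<And>q. ?\<alpha> *s T$q = (\<Sum>r\<in>UNIV. c q r *s P$r)" by metis
  obtain q p where qp: "lookup (c q p) 0 \<noteq> 0"
    using exists_transition_unit_at_0[OF fin H np P spanT, of "\<chi> q r. c q r"] c by auto
  \<comment> \<open>In degree \<open>d p\<close> the summand of index \<open>r\<close> contributes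
    the part of \<open>c q r\<close> of degree \<open>d p - d r\<close>, and nothing when
    \<open>d r\<close> exceeds \<open>d p\<close>; for \<open>r = p\<close> this part is the
    constant term.\<close>
  define e where "e r = (if d r \<le> d p then component (d p - d r) (c q r) else 0)" for r
  \<comment> \<open>The linear form has degree 1, hence the shift by 1. For \<open>d p = 0\<close> a
    multiple of it has no component of that degree, so the vector must be 0, which the truncated
    \<open>d p - 1\<close> would miss.\<close>
  define \<theta> where "\<theta> = (if 1 \<le> d p then \<chi> k. component (d p - 1) (T$q$k) else 0)"
  have "\<theta> \<in> log_vectors a I"
    using component_log_vector[OF T] by (auto simp: \<theta>_def log_vectors_def)
  moreover have "?\<alpha> *s \<theta> = (\<Sum>r\<in>UNIV. e r *s P$r)"
  proof -
    have "?\<alpha> * \<theta>$k = (\<Sum>r\<in>UNIV. e r * P$r$k)" for k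
    proof -
      have "?\<alpha> * T$q$k = (\<Sum>r\<in>UNIV. c q r * P$r$k)"
        using arg_cong[OF c[of q], of "\<lambda>v. v$k"] by simp
      then have "component (d p) (T$q$k * ?\<alpha>) = component (d p) (\<Sum>r\<in>UNIV. c q r * P$r$k)"
        by (simp only: mult.commute)
      then show ?thesis
        unfolding component_mult_homogeneous[OF homogeneous_form_poly] component_sum
        by (cases "1 \<le> d p")
          (simp_all add: component_mult_homogeneous[OF hom] e_def \<theta>_def mult.commute if_distrib[of "(*) _"] cong: if_cong)
    qed
    then show ?thesis by (simp add: vec_eq_iff)
  qed
  moreover have "e p = const (lookup (c q p) 0)" by (simp add: e_def component_degree_0)
  ultimately show ?thesis using qp by blast
qed

text \<open>Orlik and Terao's polynomial \<open>B\<close>: on each fibre of the restriction map, choose one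
  form \<open>a K0\<close>; subtracting a multiple of \<open>\<alpha>\<close> from \<open>\<theta>(\<alpha>)\<close> makes it divisible by all other forms
  of the fibre.\<close>

lemma prod_fibre_dvd_elim:
  fixes \<theta> :: "('k::field, 'n::finite) mpoly ^ 'n"
  assumes fin: "finite T" and np: "pairwise_nonproportional a (insert H (insert K0 T))" and H: "H \<notin> insert K0 T"
    and K0: "K0 \<notin> T"
    and i: "a H $ i \<noteq> 0"
    and t0: "elimv (a H) i (a K0) = t0 *s b" "t0 \<noteq> 0"
    and t: "\<And>K. K \<in> T \<Longrightarrow> elimv (a H) i (a K) = t K *s b" "\<And>K. K \<in> T \<Longrightarrow> t K \<noteq> 0"
    and \<theta>: "\<theta> \<in> log_vectors a (insert K0 T)"
  shows "form_poly b ^ card T dvd elim (a H) i (dotp \<theta> (a H))"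
proof -
  let ?\<alpha> = "form_poly (a H)"
  obtain g0 where g0: "dotp \<theta> (a K0) = form_poly (a K0) * g0"
    using \<theta> by (auto simp: log_vectors_def elim: dvdE)
  define f where "f = dotp \<theta> (a H) - g0 * ?\<alpha>"
  have "form_poly (a K) dvd f" if K: "K \<in> T" for K
  proof -
    \<comment> \<open>Hyperplanes with the same trace on \<open>H\<close> satisfy a linear relation
      with \<open>a H\<close>. Its coefficient \<open>r\<close> is invertible because
      \<open>a K\<close> and \<open>a K0\<close> are not proportional, so the relation can be solved
      for the value on \<open>a H\<close>.\<close>
    define s r where "s = t K / t0" and "r = a K $ i / a H $ i - s * (a K0 $ i / a H $ i)"
    have "elimv (a H) i (a K) = s *s elimv (a H) i (a K0)"
      using K t t0 by (simp add: s_def vec_eq_iff)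
    then have aK: "a K = s *s a K0 + r *s a H"
      by (simp add: elimv_def r_def vec_eq_iff algebra_simps)
    have "K \<noteq> K0" using K K0 by auto
    then have "r \<noteq> 0" using np K aK by (auto simp: pairwise_nonproportional_def)
    have "const r * f = dotp \<theta> (a K) - g0 * form_poly (a K)"
      by (simp add: aK g0 f_def algebra_simps)
    also have "form_poly (a K) dvd \<dots>" using \<theta> K by (simp add: log_vectors_def)
    finally have "form_poly (a K) dvd const (inverse r) * (const r * f)" by (rule dvd_mult)
    then show ?thesis by (simp only: mult.assoc[symmetric] const_inverse[OF \<open>r \<noteq> 0\<close>] mult_1_left)
  qed
  moreover have npT: "pairwise_nonproportional a T"
    using np by (rule pairwise_nonproportional_subset) auto
  ultimately have "(\<Prod>K\<in>T. form_poly (a K)) dvd f"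
    using pairwise_nonproportional_prime[OF npT] by (intro prod_primes_dvd[OF fin]) auto
  then have "elim (a H) i (\<Prod>K\<in>T. form_poly (a K)) dvd elim (a H) i f" by (rule elim_dvd)
  moreover have "elim (a H) i (\<Prod>K\<in>T. form_poly (a K)) = (\<Prod>K\<in>T. const (t K)) * form_poly b ^ card T"
    using t(1) by (simp add: prod.distrib flip: prod_constant)
  moreover have "elim (a H) i f = elim (a H) i (dotp \<theta> (a H))"
    using i by (simp add: f_def elimv_def)
  ultimately show ?thesis by (metis dvd_mult_right)
qed

text \<open>\<open>\<rho>\<close> plays the restriction map from the hyperplanes other than
  \<open>H\<close>, and \<open>b\<close> gives forms of the restricted hyperplanes in the
  coordinates left after eliminating \<open>X i\<close>. The scalars \<open>t\<close> absorb the
  free choice of each form.\<close>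

locale restricted_forms =
  fixes a :: "'i \<Rightarrow> 'k::field ^ 'n::finite" and H :: 'i and I :: "'i set" and i :: 'n
    and b :: "'x \<Rightarrow> 'k ^ 'n" and Y :: "'x set" and \<rho> :: "'i \<Rightarrow> 'x" and t :: "'i \<Rightarrow> 'k"
  assumes fin: "finite I" and H: "H \<notin> I" and np: "pairwise_nonproportional a (insert H I)"
    and i: "a H $ i \<noteq> 0"
    and Y: "Y = \<rho> ` I" and npb: "pairwise_nonproportional b Y" and bi: "\<And>x. x \<in> Y \<Longrightarrow> b x $ i = 0"
    and t: "\<And>K. K \<in> I \<Longrightarrow> elimv (a H) i (a K) = t K *s b (\<rho> K)" "\<And>K. K \<in> I \<Longrightarrow> t K \<noteq> 0"
begin

lemma finY: "finite Y" using fin Y by simp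

abbreviation "fibre x \<equiv> {K\<in>I. \<rho> K = x}"

text \<open>In each fibre one hyperplane \<open>K0\<close> is spent on the correction term, so the
  exponent is one less than the size of the fibre.\<close>

lemma prod_dvd_elim:
  assumes \<theta>: "\<theta> \<in> log_vectors a I"
  shows "(\<Prod>x\<in>Y. form_poly (b x) ^ (card (fibre x) - 1)) dvd elim (a H) i (dotp \<theta> (a H))"
proof (rule prod_prime_powers_dvd[OF finY])
  fix x assume "x \<in> Y"
  then obtain K0 where K0: "K0 \<in> I" "\<rho> K0 = x" using Y by auto
  let ?T = "fibre x - {K0}"
  have "form_poly (b x) ^ card ?T dvd elim (a H) i (dotp \<theta> (a H))"
  proof (rule prod_fibre_dvd_elim[where a = a and ?K0.0 = K0 and ?t0.0 = "t K0" and t = t])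
    show "pairwise_nonproportional a (insert H (insert K0 ?T))"
      using np K0 by (elim pairwise_nonproportional_subset) auto
    show "\<theta> \<in> log_vectors a (insert K0 ?T)" using \<theta> K0 by (auto simp: log_vectors_def)
  qed (use fin H i t K0 in auto)
  moreover have "card ?T = card (fibre x) - 1" using K0 fin by (simp add: card_Diff_singleton)
  ultimately show "form_poly (b x) ^ (card (fibre x) - 1) dvd elim (a H) i (dotp \<theta> (a H))" by simp
qed (use pairwise_nonproportional_prime[OF npb] in auto)

text \<open>Q' modulo \<alpha> is, up to a constant, Q'' times the factor found in
  \<open>prod_dvd_elim\<close>; cancelling that factor in \<open>det_bar_matrix_dvd\<close>
  therefore leaves Q''.\<close>

lemma prod_elim_forms:
  "(\<Prod>K\<in>I. elim (a H) i (form_poly (a K))) =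
     const (\<Prod>K\<in>I. t K) * (\<Prod>x\<in>Y. form_poly (b x)) * (\<Prod>x\<in>Y. form_poly (b x) ^ (card (fibre x) - 1))"
proof -
  have "(\<Prod>K\<in>I. elim (a H) i (form_poly (a K))) = const (\<Prod>K\<in>I. t K) * (\<Prod>K\<in>I. form_poly (b (\<rho> K)))"
    using t(1) by (simp add: const_prod prod.distrib)
  also have "(\<Prod>K\<in>I. form_poly (b (\<rho> K))) = (\<Prod>x\<in>Y. \<Prod>K\<in>fibre x. form_poly (b (\<rho> K)))"
    using fin finY Y by (intro prod.group[symmetric]) auto
  also have "\<dots> = (\<Prod>x\<in>Y. form_poly (b x) * form_poly (b x) ^ (card (fibre x) - 1))"
  proof (rule prod.cong[OF refl])
    fix x assume "x \<in> Y"
    \<comment> \<open>A non-empty fibre allows one factor to be split off without truncating the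
      exponent.\<close>
    then have "fibre x \<noteq> {}" using Y by auto
    then have "card (fibre x) \<noteq> 0" using fin by simp
    then show "(\<Prod>K\<in>fibre x. form_poly (b (\<rho> K))) = form_poly (b x) * form_poly (b x) ^ (card (fibre x) - 1)"
      by (simp add: power_eq_if[of _ "card (fibre x)"])
  qed
  finally show ?thesis by (simp add: prod.distrib mult.assoc)
qed

text \<open>The restrictions of the rows other than \<open>p\<close>, in the coordinates
  \<open>X k\<close> of \<open>H\<close> with \<open>k \<noteq> i\<close>, bordered by a unit row
  and an otherwise zero column to stay square over the same index type. The determinant is the
  corresponding minor up to sign.\<close>

definition bar_matrix :: "'n \<Rightarrow> ('k, 'n) mpoly ^ 'n ^ 'n \<Rightarrow> ('k, 'n) mpoly ^ 'n ^ 'n" where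
  "bar_matrix p P = (\<chi> r. if r = p then axis i 1 else \<chi> k. if k = i then 0 else elim (a H) i (P$r$k))"

lemma det_bar_matrix_dvd:
  assumes P: "\<And>r. P$r \<in> log_vectors a (insert H I)"
    and detP: "det P dvd (\<Prod>K\<in>insert H I. form_poly (a K))"
    and \<theta>: "\<theta> \<in> log_vectors a I" "form_poly (a H) *s \<theta> = (\<Sum>r\<in>UNIV. c r *s P$r)"
    and c: "c p = const u" "u \<noteq> 0"
  shows "det (bar_matrix p P) dvd (\<Prod>x\<in>Y. form_poly (b x))"
proof -
  let ?\<alpha> = "form_poly (a H)" and ?e = "elim (a H) i"
  define M where "M = (\<chi> r. if r = p then \<theta> else P$r)"
  obtain w where w: "?\<alpha> * (\<Prod>K\<in>I. form_poly (a K)) = det P * w"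
    using detP fin H by (auto elim: dvdE)
  \<comment> \<open>Row \<open>p\<close> becomes the whole combination of the rows of
    \<open>P\<close>, of which only the summand of index \<open>p\<close> contributes.\<close>
  have "?\<alpha> * det M = det (\<chi> r. if r = p then ?\<alpha> *s \<theta> else P$r)"
    unfolding M_def by (rule det_row_mul[symmetric])
  also have "\<dots> = const u * det P"
    unfolding \<theta>(2) by (simp add: det_row_combination c)
  finally have "?\<alpha> * det M * w = const u * det P * w" by (simp only:)
  then have "?\<alpha> * (det M * w) = const u * (?\<alpha> * (\<Prod>K\<in>I. form_poly (a K)))"
    unfolding w by (simp only: mult.assoc)
  then have "?\<alpha> * (det M * w) = ?\<alpha> * (const u * (\<Prod>K\<in>I. form_poly (a K)))"
    by (simp only: mult.left_commute)
  moreover have "?\<alpha> \<noteq> 0" using np by (auto simp: pairwise_nonproportional_def)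
  ultimately have Mw: "det M * w = const u * (\<Prod>K\<in>I. form_poly (a K))"
    by (simp add: mpoly_mult_cancel)
  \<comment> \<open>The values on \<alpha> are written into column \<open>i\<close> before reducing:
    they vanish after reduction in all rows but \<open>p\<close>, so the value of
    \<open>\<theta>\<close> on \<alpha> splits off as a factor.\<close>
  define G where "G = (\<chi> r k. ?e ((M ** column_op i (a H))$r$k))"
  have detG: "det G = ?e (det M) * const (a H $ i)"
    unfolding G_def elim_def subst_det[symmetric] by (simp add: det_mul det_column_op)
  let ?f = "?e (dotp \<theta> (a H))"
  let ?h = "(\<chi> k. if k = i then 0 else ?e (\<theta>$k)) :: ('k, 'n) mpoly ^ 'n"
  have row: "G$r = bar_matrix p P $ r" if "r \<noteq> p" for r
  proof -
    have "?e (dotp (P$r) (a H)) = 0"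
      using P[of r] elim_eq_0_iff[of "a H" i, OF i] by (simp add: log_vectors_def)
    then show ?thesis
      using that by (simp add: vec_eq_iff G_def mult_column_op M_def bar_matrix_def)
  qed
  have "G$p = ?f *s axis i 1 + ?h"
    by (simp add: vec_eq_iff G_def mult_column_op M_def axis_def)
  then have "G = (\<chi> r. if r = p then ?f *s axis i 1 + ?h else bar_matrix p P $ r)"
    using row by (simp add: vec_eq_iff[where 'b = 'n])
  then have "det G = det (\<chi> r. if r = p then ?f *s axis i 1 else bar_matrix p P $ r) +
      det (\<chi> r. if r = p then ?h else bar_matrix p P $ r)"
    using det_row_add[of p "\<lambda>_. ?f *s axis i 1" "\<lambda>_. ?h" "\<lambda>r. bar_matrix p P $ r"] by (simp only:)
  moreover have "det (\<chi> r. if r = p then ?h else bar_matrix p P $ r) = 0"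
    by (rule det_eq_0_if_zero_column[where k = i]) (simp add: bar_matrix_def)
  moreover have "det (\<chi> r. if r = p then ?f *s axis i 1 else bar_matrix p P $ r) =
      ?f * det (\<chi> r. if r = p then axis i 1 else bar_matrix p P $ r)"
    by (rule det_row_mul)
  moreover have "(\<chi> r. if r = p then axis i 1 else bar_matrix p P $ r) = bar_matrix p P"
    by (simp add: vec_eq_iff bar_matrix_def)
  ultimately have G: "det G = ?f * det (bar_matrix p P)" by (simp only: add_0_right)
  define Z where "Z = (\<Prod>x\<in>Y. form_poly (b x) ^ (card (fibre x) - 1))"
  have "Z dvd ?f" unfolding Z_def by (rule prod_dvd_elim[OF \<theta>(1)])
  then obtain f1 where f1: "?f = Z * f1" by (auto elim: dvdE)
  define C where "C = a H $ i * u * (\<Prod>K\<in>I. t K)"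
  have "?e (det M * w) = ?e (const u * (\<Prod>K\<in>I. form_poly (a K)))" by (simp only: Mw)
  then have "?e (det M) * ?e w = const u * (const (\<Prod>K\<in>I. t K) * (\<Prod>x\<in>Y. form_poly (b x)) * Z)"
    unfolding elim_simps prod_elim_forms Z_def .
  then have "const (a H $ i) * (?e (det M) * ?e w) =
      const (a H $ i) * (const u * (const (\<Prod>K\<in>I. t K) * (\<Prod>x\<in>Y. form_poly (b x)) * Z))"
    by (simp only:)
  then have "(?e (det M) * const (a H $ i)) * ?e w = Z * (const C * (\<Prod>x\<in>Y. form_poly (b x)))"
    by (simp add: C_def mult_ac)
  then have "Z * (f1 * det (bar_matrix p P) * ?e w) = Z * (const C * (\<Prod>x\<in>Y. form_poly (b x)))"
    unfolding detG[symmetric] G f1 by (simp only: mult_ac)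
  moreover have "Z \<noteq> 0"
    using finY npb by (auto simp: Z_def mpoly_prod_eq_0_iff mpoly_power_eq_0_iff pairwise_nonproportional_def)
  ultimately have eq: "f1 * det (bar_matrix p P) * ?e w = const C * (\<Prod>x\<in>Y. form_poly (b x))"
    by (simp add: mpoly_mult_cancel)
  have "C \<noteq> 0" using i c t(2) fin by (auto simp: C_def)
  have "(\<Prod>x\<in>Y. form_poly (b x)) = const (inverse C) * (f1 * det (bar_matrix p P) * ?e w)"
    unfolding eq by (simp only: mult.assoc[symmetric] const_inverse[OF \<open>C \<noteq> 0\<close>] mult_1_left)
  then show ?thesis by (simp add: mult_ac)
qed

text \<open>The form \<open>b x\<close> does not involve \<open>X i\<close>, so neither the unit row
  nor the zeros in column \<open>i\<close> disturb the pairing. The other rows inherit the condition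
  from a hyperplane \<open>K\<close> over \<open>x\<close>.\<close>

lemma bar_matrix_row_log:
  assumes "\<And>r. P$r \<in> log_vectors a (insert H I)" and x: "x \<in> Y"
  shows "form_poly (b x) dvd dotp (bar_matrix p P $ r) (b x)"
proof (cases "r = p")
  case True
  then show ?thesis using bi[OF x] by (simp add: bar_matrix_def)
next
  case False
  obtain K where K: "K \<in> I" "x = \<rho> K" using x Y by auto
  let ?e = "elim (a H) i"
  have "dotp (bar_matrix p P $ r) (b x) = ?e (dotp (P$r) (b x))"
    using bi[OF x] False by (auto simp: dotp_def bar_matrix_def intro!: sum.cong)
  moreover have "?e (dotp (P$r) (a H)) = 0"
    using assms(1)[of r] elim_eq_0_iff[of "a H" i, OF i] by (simp add: log_vectors_def)
  then have "?e (dotp (P$r) (elimv (a H) i (a K))) = ?e (dotp (P$r) (a K))"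
    by (simp add: elimv_def)
  then have "const (t K) * ?e (dotp (P$r) (b x)) = ?e (dotp (P$r) (a K))"
    using t(1)[OF K(1)] K by simp
  moreover have "?e (form_poly (a K)) dvd ?e (dotp (P$r) (a K))"
    using assms(1)[of r] K by (intro elim_dvd) (simp add: log_vectors_def)
  then have "form_poly (b x) dvd ?e (dotp (P$r) (a K))"
    using t(1)[OF K(1)] K by (simp add: dvd_mult_right)
  ultimately have "form_poly (b x) dvd const (inverse (t K)) * (const (t K) * dotp (bar_matrix p P $ r) (b x))"
    by simp
  then show ?thesis by (simp only: mult.assoc[symmetric] const_inverse[OF t(2)[OF K(1)]] mult_1_left)
qed

text \<open>Cramer's rule for an arbitrary logarithmic \<open>h\<close>: each numerator is the
  determinant of logarithmic rows, hence divisible by Q'' and therefore by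
  \<open>det (bar_matrix p P)\<close>.\<close>

lemma exists_bar_basis:
  fixes P T :: "('k::field, 'n::finite) mpoly ^ 'n ^ 'n"
  assumes P: "\<And>r. P$r \<in> log_vectors a (insert H I)"
    and spanP: "\<And>h. h \<in> log_vectors a (insert H I) \<Longrightarrow> \<exists>c. h = (\<Sum>r\<in>UNIV. c r *s P$r)"
    and hom: "\<And>r k. homogeneous (d r) (P$r$k)"
    and T: "\<And>r. T$r \<in> log_vectors a I"
    and spanT: "\<And>h. h \<in> log_vectors a I \<Longrightarrow> \<exists>c. h = (\<Sum>r\<in>UNIV. c r *s T$r)"
  shows "\<exists>p.
    (\<forall>h\<in>log_vectors b Y. h$i = 0 \<longrightarrow> (\<exists>c. h = (\<Sum>r\<in>UNIV - {p}. c r *s bar_matrix p P $ r))) \<and>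
    (\<forall>c. (\<Sum>r\<in>UNIV - {p}. c r *s bar_matrix p P $ r) = 0 \<longrightarrow> (\<forall>r\<in>UNIV - {p}. c r = 0))"
proof -
  obtain p c u \<theta> where \<theta>: "\<theta> \<in> log_vectors a I" "form_poly (a H) *s \<theta> = (\<Sum>r\<in>UNIV. c r *s P$r)"
      and c: "c p = const u" "u \<noteq> 0"
    using exists_homogeneous_relation[OF fin H np P spanP hom T spanT] by blast
  let ?B = "bar_matrix p P"
  have "det P dvd (\<Prod>K\<in>insert H I. form_poly (a K))"
    using det_dvd_prod_forms[OF _ np spanP] fin by simp
  then have dvd: "det ?B dvd (\<Prod>x\<in>Y. form_poly (b x))"
    using det_bar_matrix_dvd[OF P _ \<theta> c] by blast
  moreover have "(\<Prod>x\<in>Y. form_poly (b x)) \<noteq> 0"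
    using finY npb by (auto simp: mpoly_prod_eq_0_iff pairwise_nonproportional_def)
  ultimately have nz: "det ?B \<noteq> 0" by auto
  show ?thesis
  proof (intro exI[of _ p] conjI ballI allI impI)
    fix h assume h: "h \<in> log_vectors b Y" "h$i = 0"
    define e where "e r = det (\<chi> s. if s = r then h else ?B$s)" for r
    have "(\<Prod>x\<in>Y. form_poly (b x)) dvd e r" for r
      unfolding e_def
    proof (rule prod_forms_dvd_det[OF finY npb])
      fix s show "(\<chi> s. if s = r then h else ?B$s)$s \<in> log_vectors b Y"
        using h(1) bar_matrix_row_log[OF P] by (simp add: log_vectors_def)
    qed
    then have "\<exists>e'. e r = det ?B * e'" for r using dvd_trans[OF dvd] by (blast elim: dvdE)
    then obtain e' where e': "\<And>r. e r = det ?B * e' r" by metis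
    have "(\<Sum>r\<in>UNIV. e r *s ?B$r) = det ?B *s h" unfolding e_def by (rule cramer_rows)
    then have "det ?B * (\<Sum>r\<in>UNIV. e' r *s ?B$r)$k = det ?B * h$k" for k
      unfolding vec_eq_iff by (simp add: e' sum_distrib_left mult.assoc)
    then have heq: "h = (\<Sum>r\<in>UNIV. e' r *s ?B$r)"
      using nz by (simp add: mpoly_mult_cancel vec_eq_iff)
    also have split: "\<dots> = e' p *s ?B$p + (\<Sum>r\<in>UNIV - {p}. e' r *s ?B$r)"
      by (rule sum.remove) auto
    \<comment> \<open>Row \<open>p\<close> alone has a non-zero entry in column \<open>i\<close>, so
      \<open>h$i = 0\<close> removes it from the combination.\<close>
    finally have "h$i = e' p" by (simp add: bar_matrix_def)
    then have "h = (\<Sum>r\<in>UNIV - {p}. e' r *s ?B$r)" using heq split h(2) by simp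
    then show "\<exists>c. h = (\<Sum>r\<in>UNIV - {p}. c r *s ?B$r)" by blast
  next
    fix c :: "'n \<Rightarrow> ('k, 'n) mpoly" and r
    assume 0: "(\<Sum>r\<in>UNIV - {p}. c r *s ?B$r) = 0" and r: "r \<in> UNIV - {p}"
    have "c r * det ?B = det (\<chi> s. if s = r then \<Sum>j\<in>UNIV - {p}. c j *s ?B$j else ?B$s)"
      using r by (simp add: det_row_combination)
    also have "\<dots> = 0" unfolding 0 by (rule det_row_0)
    finally have "c r * det ?B = 0" .
    then show "c r = 0" using nz by simp
  qed
qed

end


section \<open>Hyperplanes and derivations\<close>

text \<open>The vectors \<open>c'$j *s axis k 1 - c'$k *s axis j 1\<close> lie in the kernel of
  \<open>c'\<close>; that they also lie in the kernel of \<open>c\<close> makes \<open>c\<close>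
  proportional to \<open>c'\<close>. The zero form is treated apart.\<close>

lemma form_kernel_eqD:
  assumes "form_kernel c = form_kernel c'"
  shows "\<exists>t. t \<noteq> 0 \<and> c = t *s c'"
proof (cases "c' = 0")
  case True
  have "axis k 1 \<in> form_kernel c" for k using True unfolding assms by (simp add: form_kernel_def)
  then have "c$k = 0" for k by (simp add: form_kernel_def axis_def if_distrib[of "(*) _"] cong: if_cong)
  then show ?thesis using True by (intro exI[of _ 1]) (simp add: vec_eq_iff)
next
  case False
  then obtain j where j: "c'$j \<noteq> 0" by (auto simp: vec_eq_iff)
  have ker: "c'$j *s axis k 1 - c'$k *s axis j 1 \<in> form_kernel d \<longleftrightarrow> d$k * c'$j = d$j * c'$k" for k d
    by (simp add: form_kernel_def axis_def right_diff_distrib sum_subtractf if_distrib[of "(*) _"] cong: if_cong)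
  have "c$k * c'$j = c$j * c'$k" for k
    using ker[of k c] ker[of k c'] assms by (simp add: mult.commute)
  then have c: "c = (c$j / c'$j) *s c'" using j by (simp add: vec_eq_iff field_simps)
  have "c$j \<noteq> 0"
  proof
    assume "c$j = 0"
    then have "c = 0" using c by simp
    then have "axis j 1 \<in> form_kernel c'" unfolding assms[symmetric] by (simp add: form_kernel_def)
    then show False using j by (simp add: form_kernel_def axis_def if_distrib[of "(*) _"] cong: if_cong)
  qed
  then show ?thesis using c j by (intro exI[of _ "c$j / c'$j"]) simp
qed

lemma hyperplane_eq_form_kernel:
  fixes K :: "('k::field ^ 'n::finite) set"
  assumes "hyperplane_in UNIV K"
  obtains a where "a \<noteq> 0" "form_kernel a = K"
proof -
  have K: "vec.subspace K" and dim: "vec.dim K + 1 = CARD('n)"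
    using assms by (auto simp: hyperplane_in_def card_cart_basis)
  obtain B where B: "B \<subseteq> K" "vec.independent B" "K \<subseteq> vec.span B" "card B = vec.dim K"
    using vec.basis_exists by blast
  have spanB: "vec.span B = K" using B K by (metis vec.span_subspace)
  have "K \<noteq> UNIV" using dim by (metis add_cancel_right_right card_cart_basis vec.dim_UNIV zero_neq_one)
  then obtain v where v: "v \<notin> K" by blast
  then have indep: "vec.independent (insert v B)" using B(2) spanB by (simp add: vec.independent_insert)
  have vB: "v \<notin> B" using v B(1) by blast
  have "card (insert v B) = CARD('n)"
    using vB dim B vec.finiteI_independent[OF B(2)] by simp
  then have "vec.dim (vec.span (insert v B)) = vec.dim (UNIV :: ('k ^ 'n) set)"
    using vec.dim_eq_card_independent[OF indep] by (simp add: vec.dim_span card_cart_basis)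
  then have spanU: "vec.span (insert v B) = UNIV"
    by (intro vec.subspace_dim_equal) auto
  \<comment> \<open>Any coordinate will do: a linear map with values in the line of
    \<open>axis k0 1\<close> plays the part of a functional.\<close>
  obtain k0 :: 'n where True by blast
  obtain L where L: "Vector_Spaces.linear (*s) (*s) L" "\<And>x. x \<in> insert v B \<Longrightarrow> L x = (if x = v then axis k0 1 else 0)"
    using vec.linear_independent_extend[OF indep, of "\<lambda>x. if x = v then axis k0 1 else (0 :: 'k ^ 'n)"] by blast
  interpret L: Vector_Spaces.linear "(*s)" "(*s)" L by (rule L(1))
  define a where "a = (\<chi> k. L (axis k 1) $ k0)"
  have La: "(\<Sum>k\<in>UNIV. a$k * x$k) = L x $ k0" for x
  proof -
    have "L x = (\<Sum>k\<in>UNIV. x$k *s L (axis k 1))"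
      by (subst vec_eq_sum_axis[of x]) (simp add: L.sum L.scale)
    then show ?thesis by (simp add: a_def mult.commute)
  qed
  have LK: "L x = 0" if "x \<in> K" for x
  proof (rule L.eq_0_on_span)
    show "x \<in> vec.span B" using that spanB by simp
  qed (use L(2) vB in auto)
  have "x \<in> K" if x: "x \<in> form_kernel a" for x
  proof -
    have "x \<in> vec.span (insert v B)" using spanU by simp
    then obtain s where s: "x - s *s v \<in> vec.span B" by (auto simp: vec.span_insert)
    have "L (x - s *s v) = 0" using LK s spanB by blast
    then have "L x = s *s axis k0 1" using L(2)[of v] by (simp add: L.diff L.scale)
    then have "s = 0" using x La[of x] by (simp add: form_kernel_def)
    then show ?thesis using s spanB by simp
  qed
  moreover have "x \<in> form_kernel a" if "x \<in> K" for x
    using LK[OF that] La[of x] by (simp add: form_kernel_def)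
  ultimately have "form_kernel a = K" by blast
  moreover have "a \<noteq> 0"
  proof
    assume "a = 0"
    then show False using \<open>form_kernel a = K\<close> v by (auto simp: form_kernel_def)
  qed
  ultimately show ?thesis using that by blast
qed

definition normal_in :: "('k::field ^ 'n::finite) set \<Rightarrow> ('k ^ 'n) set \<Rightarrow> 'k ^ 'n" where
  "normal_in W K = (SOME a. W \<inter> form_kernel a = K)"

lemma defining_form_eq: "defining_form W K = form_poly (normal_in W K)"
  by (simp add: defining_form_def normal_in_def)

lemma form_kernel_normal_in: "W \<inter> form_kernel a = K \<Longrightarrow> W \<inter> form_kernel (normal_in W K) = K"
  unfolding normal_in_def by (rule someI)

lemma arrangement_form_kernel:
  assumes "arrangement A" "K \<in> A"
  shows "form_kernel (normal_in UNIV K) = K"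
proof -
  obtain a where "form_kernel a = K"
    using assms hyperplane_eq_form_kernel unfolding arrangement_def by blast
  then show ?thesis using form_kernel_normal_in[of UNIV a K] by simp
qed

lemma form_kernel_smult: "t \<noteq> 0 \<Longrightarrow> form_kernel (t *s a) = form_kernel a"
  by (simp add: form_kernel_def mult.assoc flip: sum_distrib_left)

lemma arrangement_pairwise_nonproportional:
  fixes A :: "('k::field ^ 'n::finite) set set"
  assumes "arrangement A"
  shows "pairwise_nonproportional (normal_in UNIV) A"
proof -
  have nz: "normal_in UNIV K \<noteq> 0" if K: "K \<in> A" for K
  proof
    assume "normal_in UNIV K = 0"
    then have "K = UNIV" using arrangement_form_kernel[OF assms K] by (simp add: form_kernel_def)
    moreover obtain a where "a \<noteq> 0" "form_kernel a = K"
      using assms K hyperplane_eq_form_kernel unfolding arrangement_def by blast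
    ultimately have "form_kernel a = form_kernel 0" by (simp add: form_kernel_def)
    then obtain t where "a = t *s 0" using form_kernel_eqD[of a 0] by blast
    then show False using \<open>a \<noteq> 0\<close> by (simp add: vec_eq_iff)
  qed
  moreover have "normal_in UNIV K' \<noteq> t *s normal_in UNIV K" if "K \<in> A" "K' \<in> A" "K \<noteq> K'" for K K' t
  proof
    assume eq: "normal_in UNIV K' = t *s normal_in UNIV K"
    then have "t \<noteq> 0" using nz[OF that(2)] by auto
    then have "K' = K"
      using arrangement_form_kernel[OF assms] that form_kernel_smult eq by metis
    then show False using that by simp
  qed
  ultimately show ?thesis by (simp add: pairwise_nonproportional_def)
qed

section \<open>Derivations as coefficient vectors\<close>

definition derivation_of ::
  "('k::field, 'n::finite) mpoly ^ 'n \<Rightarrow> ('k, 'n) mpoly \<Rightarrow> ('k, 'n) mpoly" where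
  "derivation_of g f = (\<Sum>k\<in>UNIV. g$k * partial k f)"

lemma derivation_of_add [simp]: "derivation_of g (f + h) = derivation_of g f + derivation_of g h"
  by (simp add: derivation_of_def distrib_left sum.distrib)

lemma derivation_of_mult: "derivation_of g (f * h) = f * derivation_of g h + h * derivation_of g f"
  by (simp add: derivation_of_def partial_mult distrib_left sum.distrib sum_distrib_left mult_ac)

lemma derivation_of_const [simp]: "derivation_of g (const c) = 0"
  by (simp add: derivation_of_def)

lemma derivation_of_simps [simp]: "derivation_of g 0 = 0" "derivation_of g 1 = 0"
  using derivation_of_const[of g 0] derivation_of_const[of g 1] by simp_all

lemma derivation_of_X [simp]: "derivation_of g (X k) = g$k"
  by (simp add: derivation_of_def partial_X if_distrib[of "(*) _"] cong: if_cong)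

lemma derivation_of_sum_right: "derivation_of g (sum f I) = (\<Sum>i\<in>I. derivation_of g (f i))"
  by (induction I rule: infinite_finite_induct) auto

lemma derivation_of_form_poly: "derivation_of g (form_poly b) = dotp g b"
  by (simp add: form_poly_eq_dotp dotp_def derivation_of_sum_right derivation_of_mult)

lemma derivation_of_prod:
  "finite I \<Longrightarrow> derivation_of g (prod y I) = (\<Sum>i\<in>I. prod y (I - {i}) * derivation_of g (y i))"
proof (induction I rule: finite_induct)
  case (insert j I)
  have "prod y (insert j I - {i}) = y j * prod y (I - {i})" if "i \<in> I" for i
  proof -
    have "insert j I - {i} = insert j (I - {i})" using insert.hyps that by auto
    then show ?thesis using insert.hyps by simp
  qed
  then have "(\<Sum>i\<in>I. prod y (insert j I - {i}) * derivation_of g (y i)) =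
      y j * (\<Sum>i\<in>I. prod y (I - {i}) * derivation_of g (y i))"
    by (simp add: sum_distrib_left mult.assoc)
  moreover have "insert j I - {j} = I" using insert.hyps by auto
  ultimately show ?case using insert by (simp add: derivation_of_mult add.commute)
qed simp

lemma derivation_of_combination:
  "derivation_of (\<Sum>j\<in>F. c j *s g j) f = (\<Sum>j\<in>F. c j * derivation_of (g j) f)"
  by (simp add: derivation_of_def sum_distrib_left sum_distrib_right mult.assoc)
    (rule sum.swap)

lemma derivation_of_inject: "derivation_of g = derivation_of h \<longleftrightarrow> g = h"
  by (metis derivation_of_X vec_eq_iff)

lemma derivation_of_mem: "derivation_of g \<in> derivations S_ring const"
  by (simp add: derivations_def derivation_of_mult)

lemma derivation_eq_derivation_of:
  assumes "\<theta> \<in> derivations S_ring const"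
  shows "\<theta> = derivation_of (\<chi> k. \<theta> (X k))"
proof
  have add: "\<theta> (f + g) = \<theta> f + \<theta> g" and scale: "\<theta> (const c * f) = const c * \<theta> f"
    and mult: "\<theta> (f * g) = f * \<theta> g + g * \<theta> f" for f g c
    using assms by (auto simp: derivations_def)
  have "\<theta> 1 = 0" using mult[of 1 1] by simp
  then have const: "\<theta> (const c) = 0" for c using scale[of c 1] by simp
  fix f show "\<theta> f = derivation_of (\<chi> k. \<theta> (X k)) f"
    by (induction f rule: mpoly_induct) (simp_all add: add mult const derivation_of_mult)
qed

section \<open>Finite sums of logarithmic derivations over a commutative ring\<close>

context cring
begin

context
  fixes \<iota> :: "'k \<Rightarrow> 'a" and Q :: 'a and M
  assumes \<iota>: "\<And>c. \<iota> c \<in> carrier R" and Q: "Q \<in> carrier R"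
  defines "M \<equiv> log_derivations R \<iota> Q"
begin

lemma log_derivations_carrierD:
  assumes "\<theta> \<in> carrier M"
  shows "\<theta> \<in> extensional (carrier R)" "f \<in> carrier R \<Longrightarrow> \<theta> f \<in> carrier R"
    "\<theta> \<in> derivations R \<iota>" "\<theta> Q \<in> PIdl Q"
  using assms by (auto simp: M_def log_derivations_def derivations_def PiE_def)

lemma log_derivations_add_closed:
  assumes "\<theta> \<in> carrier M" "\<eta> \<in> carrier M"
  shows "\<theta> \<oplus>\<^bsub>M\<^esub> \<eta> \<in> carrier M"
proof -
  interpret I: ideal "PIdl Q" R by (rule cgenideal_ideal[OF Q])
  have "\<theta> Q \<oplus> \<eta> Q \<in> PIdl Q"
    using assms by (intro I.a_closed) (auto dest: log_derivations_carrierD)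
  moreover have "(\<lambda>f\<in>carrier R. \<theta> f \<oplus> \<eta> f) \<in> derivations R \<iota>"
    using assms[THEN log_derivations_carrierD(3)] \<iota>
    by (auto simp: derivations_def PiE_def Pi_iff a_ac r_distr)
  ultimately show ?thesis using Q by (simp add: M_def log_derivations_def)
qed

lemma log_derivations_smult_closed:
  assumes "c \<in> carrier R" "\<theta> \<in> carrier M"
  shows "c \<odot>\<^bsub>M\<^esub> \<theta> \<in> carrier M"
proof -
  interpret I: ideal "PIdl Q" R by (rule cgenideal_ideal[OF Q])
  have "c \<otimes> \<theta> Q \<in> PIdl Q"
    using assms by (intro I.I_l_closed) (auto dest: log_derivations_carrierD)
  moreover have "(\<lambda>f\<in>carrier R. c \<otimes> \<theta> f) \<in> derivations R \<iota>"
    using assms(2)[THEN log_derivations_carrierD(3)] assms(1) \<iota>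
    by (auto simp: derivations_def PiE_def Pi_iff m_ac r_distr)
  ultimately show ?thesis using Q by (simp add: M_def log_derivations_def)
qed

lemma log_derivations_zero_closed: "\<zero>\<^bsub>M\<^esub> \<in> carrier M"
proof -
  interpret I: ideal "PIdl Q" R by (rule cgenideal_ideal[OF Q])
  have "(\<lambda>f\<in>carrier R. \<zero>) \<in> derivations R \<iota>"
    using \<iota> by (auto simp: derivations_def)
  then show ?thesis using Q I.zero_closed by (simp add: M_def log_derivations_def)
qed

text \<open>The structure in which \<open>finsum\<close> is computed; stated over a general ring so
  as to serve both S and S/\<alpha> S.\<close>

lemma log_derivations_abelian_monoid: "abelian_monoid M"
proof (rule abelian_monoidI)
  fix \<theta> \<eta> \<zeta> assume mem: "\<theta> \<in> carrier M" "\<eta> \<in> carrier M" "\<zeta> \<in> carrier M"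
  note clo = mem[THEN log_derivations_carrierD(2)]
  have ext: "\<theta> = (\<lambda>f\<in>carrier R. \<theta> f)"
    using log_derivations_carrierD(1)[OF mem(1)] by (simp add: extensional_restrict)
  show "\<theta> \<oplus>\<^bsub>M\<^esub> \<eta> \<oplus>\<^bsub>M\<^esub> \<zeta> = \<theta> \<oplus>\<^bsub>M\<^esub> (\<eta> \<oplus>\<^bsub>M\<^esub> \<zeta>)"
    using clo by (auto simp: M_def log_derivations_def a_assoc)
  show "\<theta> \<oplus>\<^bsub>M\<^esub> \<eta> = \<eta> \<oplus>\<^bsub>M\<^esub> \<theta>"
    using clo by (auto simp: M_def log_derivations_def a_comm)
  show "\<zero>\<^bsub>M\<^esub> \<oplus>\<^bsub>M\<^esub> \<theta> = \<theta>"
    \<comment> \<open>Adding zero yields a function restricted to the carrier, which is the original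
      one by extensionality.\<close>
    by (subst (2) ext) (use clo in \<open>auto simp: M_def log_derivations_def\<close>)
qed (auto intro: log_derivations_add_closed log_derivations_zero_closed)

lemma log_derivations_finsum_closed:
  assumes "c \<in> F \<rightarrow> carrier R" "b \<in> F \<rightarrow> carrier M"
  shows "(\<Oplus>\<^bsub>M\<^esub>j\<in>F. c j \<odot>\<^bsub>M\<^esub> b j) \<in> carrier M"
  using assms by (intro abelian_monoid.finsum_closed[OF log_derivations_abelian_monoid])
    (auto intro: log_derivations_smult_closed)

lemma log_derivations_finsum_apply:
  assumes "finite F" "c \<in> F \<rightarrow> carrier R" "b \<in> F \<rightarrow> carrier M" "f \<in> carrier R"
  shows "(\<Oplus>\<^bsub>M\<^esub>j\<in>F. c j \<odot>\<^bsub>M\<^esub> b j) f = (\<Oplus>j\<in>F. c j \<otimes> b j f)"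
  using assms
proof (induction F rule: finite_induct)
  case empty
  then show ?case
    by (simp add: abelian_monoid.finsum_empty[OF log_derivations_abelian_monoid])
      (simp add: M_def log_derivations_def)
next
  case (insert x F)
  have "(\<Oplus>\<^bsub>M\<^esub>j\<in>insert x F. c j \<odot>\<^bsub>M\<^esub> b j) = c x \<odot>\<^bsub>M\<^esub> b x \<oplus>\<^bsub>M\<^esub> (\<Oplus>\<^bsub>M\<^esub>j\<in>F. c j \<odot>\<^bsub>M\<^esub> b j)"
    using insert by (intro abelian_monoid.finsum_insert[OF log_derivations_abelian_monoid])
      (auto intro: log_derivations_smult_closed)
  moreover have "(\<theta> \<oplus>\<^bsub>M\<^esub> \<eta>) f = \<theta> f \<oplus> \<eta> f" "(a \<odot>\<^bsub>M\<^esub> \<theta>) f = a \<otimes> \<theta> f" for \<theta> \<eta> a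
    using insert.prems by (simp_all add: M_def log_derivations_def)
  moreover have "(\<Oplus>j\<in>insert x F. c j \<otimes> b j f) = c x \<otimes> b x f \<oplus> (\<Oplus>j\<in>F. c j \<otimes> b j f)"
    using insert.hyps insert.prems log_derivations_carrierD(2) by (intro finsum_insert) (auto simp: Pi_iff)
  ultimately show ?case using insert by simp
qed

end

end


section \<open>The modules of logarithmic derivations\<close>

lemma finsum_S_ring: "finite F \<Longrightarrow> finsum S_ring h F = sum h F"
proof (induction F rule: finite_induct)
  interpret cring S_ring by (rule cring_S_ring)
  case empty
  show ?case by simp
next
  interpret cring S_ring by (rule cring_S_ring)
  case (insert x F)
  then show ?case using finsum_insert[of F x h] by simp
qed

lemma PIdl_S_ring: "PIdl\<^bsub>S_ring\<^esub> q = {f. q dvd f}"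
  by (auto simp: cgenideal_def dvd_def mult.commute)

text \<open>The Leibniz rule expands the value on \<open>Q_poly A\<close>, and
  \<open>prod_dvd_logarithmic_sum_iff\<close> splits the divisibility into one condition per
  hyperplane.\<close>

lemma carrier_D_module:
  assumes "arrangement A"
  shows "carrier (D_module A) = derivation_of ` log_vectors (normal_in UNIV) A"
proof -
  have fin: "finite A" using assms by (simp add: arrangement_def)
  note np = arrangement_pairwise_nonproportional[OF assms]
  have "derivation_of g (Q_poly A) \<in> PIdl\<^bsub>S_ring\<^esub> (Q_poly A) \<longleftrightarrow> g \<in> log_vectors (normal_in UNIV) A" for g
    using prod_dvd_logarithmic_sum_iff[OF fin pairwise_nonproportional_prime[OF np], where h = "\<lambda>K. dotp g (normal_in UNIV K)"]
    by (simp add: PIdl_S_ring Q_poly_def defining_form_eq derivation_of_prod[OF fin] derivation_of_form_poly log_vectors_def)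
  moreover have "derivations S_ring const = range derivation_of"
    using derivation_eq_derivation_of derivation_of_mem by blast
  ultimately show ?thesis by (auto simp: D_module_def log_derivations_def)
qed

lemma finsum_D_module:
  assumes A: "arrangement A" and F: "finite F" and b: "\<And>j. j \<in> F \<Longrightarrow> derivation_of (g j) \<in> carrier (D_module A)"
  shows "(\<Oplus>\<^bsub>D_module A\<^esub>j\<in>F. c j \<odot>\<^bsub>D_module A\<^esub> derivation_of (g j)) = derivation_of (\<Sum>j\<in>F. c j *s g j)"
proof
  interpret cring S_ring by (rule cring_S_ring)
  fix f
  show "(\<Oplus>\<^bsub>D_module A\<^esub>j\<in>F. c j \<odot>\<^bsub>D_module A\<^esub> derivation_of (g j)) f = derivation_of (\<Sum>j\<in>F. c j *s g j) f"
    unfolding D_module_def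
    by (subst log_derivations_finsum_apply[OF _ _ F])
      (use b in \<open>auto simp: D_module_def finsum_S_ring[OF F] derivation_of_combination\<close>)
qed

text \<open>The passage from abstract bases to square matrices. It serves the given basis of D(A) as
  well as the basis behind the freeness of A', whose index set is a set of derivations.\<close>

lemma D_module_basis_matrix:
  fixes A :: "('k::field ^ 'n::finite) set set"
  assumes A: "arrangement A" and basis: "module_basis S_ring (D_module A) \<psi> J"
  shows "\<exists>(\<kappa> :: 'n \<Rightarrow> 'j) P. bij_betw \<kappa> UNIV J \<and>
    (\<forall>r. \<psi> (\<kappa> r) = derivation_of (P$r) \<and> P$r \<in> log_vectors (normal_in UNIV) A) \<and>
    (\<forall>h\<in>log_vectors (normal_in UNIV) A. \<exists>c. h = (\<Sum>r\<in>UNIV. c r *s P$r))"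
proof -
  let ?L = "log_vectors (normal_in UNIV) A"
  have fin: "finite A" using A by (simp add: arrangement_def)
  note np = arrangement_pairwise_nonproportional[OF A]
  note carrier = carrier_D_module[OF A]
  have mem: "\<psi> j \<in> carrier (D_module A)" if "j \<in> J" for j
    using basis that by (auto simp: module_basis_def)
  then have "\<forall>j\<in>J. \<exists>g\<in>?L. \<psi> j = derivation_of g" unfolding carrier by blast
  then obtain g where g: "\<And>j. j \<in> J \<Longrightarrow> g j \<in> ?L" "\<And>j. j \<in> J \<Longrightarrow> \<psi> j = derivation_of (g j)"
    by metis
  have sum: "(\<Oplus>\<^bsub>D_module A\<^esub>j\<in>F. c j \<odot>\<^bsub>D_module A\<^esub> \<psi> j) = derivation_of (\<Sum>j\<in>F. c j *s g j)"
    if F: "finite F" "F \<subseteq> J" for F c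
  proof -
    interpret M: abelian_monoid "D_module A"
      unfolding D_module_def by (rule cring.log_derivations_abelian_monoid[OF cring_S_ring]) auto
    have "(\<Oplus>\<^bsub>D_module A\<^esub>j\<in>F. c j \<odot>\<^bsub>D_module A\<^esub> \<psi> j) =
        (\<Oplus>\<^bsub>D_module A\<^esub>j\<in>F. c j \<odot>\<^bsub>D_module A\<^esub> derivation_of (g j))"
    proof (rule M.finsum_cong')
      show "(\<lambda>j. c j \<odot>\<^bsub>D_module A\<^esub> derivation_of (g j)) \<in> F \<rightarrow> carrier (D_module A)"
        using mem g F cring.log_derivations_smult_closed[OF cring_S_ring, of const "Q_poly A"]
        by (auto simp: D_module_def)
    qed (use g F in auto)
    then show ?thesis using finsum_D_module[OF A F(1), of g c] mem g F by auto
  qed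
  have zero: "\<zero>\<^bsub>D_module A\<^esub> = derivation_of 0"
    by (rule ext) (simp add: D_module_def log_derivations_def derivation_of_def)
  define E :: "('k, 'n) mpoly ^ 'n ^ 'n" where
    "E = (\<chi> r. (\<Prod>K\<in>A. form_poly (normal_in UNIV K)) *s axis r 1)"
  have E: "det E \<noteq> 0" "\<And>r. E$r \<in> ?L"
    unfolding E_def using scaled_identity[OF fin, of "normal_in UNIV"] fin np
    by (auto simp: mpoly_power_eq_0_iff mpoly_prod_eq_0_iff pairwise_nonproportional_def)
  have span: "\<exists>F c. finite F \<and> F \<subseteq> J \<and> h = (\<Sum>j\<in>F. c j *s g j)" if "h \<in> ?L" for h
  proof -
    have h: "derivation_of h \<in> carrier (D_module A)" using that carrier by blast
    have "\<forall>m\<in>carrier (D_module A). \<exists>F c. finite F \<and> F \<subseteq> J \<and> c \<in> F \<rightarrow> carrier S_ring \<and>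
        m = (\<Oplus>\<^bsub>D_module A\<^esub>j\<in>F. c j \<odot>\<^bsub>D_module A\<^esub> \<psi> j)"
      using basis unfolding module_basis_def by (elim conjE)
    from bspec[OF this h] obtain F c where F: "finite F" "F \<subseteq> J"
      "derivation_of h = (\<Oplus>\<^bsub>D_module A\<^esub>j\<in>F. c j \<odot>\<^bsub>D_module A\<^esub> \<psi> j)"
      by (elim exE conjE)
    then have "h = (\<Sum>j\<in>F. c j *s g j)" using sum[OF F(1,2), of c] by (simp add: derivation_of_inject)
    then show ?thesis using F by blast
  qed
  have indep: "c j = 0" if "finite F" "F \<subseteq> J" "(\<Sum>j\<in>F. c j *s g j) = 0" "j \<in> F" for F c j
    using basis that sum[OF that(1,2), of c] unfolding module_basis_def zero by auto
  show ?thesis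
  proof (rule basis_bij_betw[of J g ?L E])
    fix \<kappa> :: "'n \<Rightarrow> 'j"
    assume bij: "bij_betw \<kappa> UNIV J"
      and \<kappa>: "\<And>h. h \<in> ?L \<Longrightarrow> \<exists>c. h = (\<Sum>r\<in>UNIV. c r *s g (\<kappa> r))"
    have "\<kappa> r \<in> J" for r using bij by (auto simp: bij_betw_def)
    then show ?thesis
      using g bij \<kappa> by (intro exI[of _ \<kappa>] exI[of _ "\<chi> r. g (\<kappa> r)"]) simp
  qed (fact g(1) E | rule span indep; assumption)+
qed

section \<open>The coordinate ring of the hyperplane and its derivations\<close>

lemma to_S_bar_hom: "to_S_bar H \<in> ring_hom S_ring (S_bar H)"
  unfolding S_bar_def to_S_bar_def[abs_def] by (rule ideal.rcos_ring_hom[OF ideal_H_ideal])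

lemma S_bar_simps [simp]:
  "to_S_bar H f \<in> carrier (S_bar H)"
  "to_S_bar H f \<oplus>\<^bsub>S_bar H\<^esub> to_S_bar H g = to_S_bar H (f + g)"
  "to_S_bar H f \<otimes>\<^bsub>S_bar H\<^esub> to_S_bar H g = to_S_bar H (f * g)"
  "\<one>\<^bsub>S_bar H\<^esub> = to_S_bar H 1"
  using ring_hom_add[OF to_S_bar_hom, of f g H] ring_hom_mult[OF to_S_bar_hom, of f g H]
    ring_hom_one[OF to_S_bar_hom, of H]
  by (simp_all add: carrier_S_bar)

lemma S_bar_zero: "\<zero>\<^bsub>S_bar H\<^esub> = to_S_bar H 0"
  by (simp add: S_bar_def FactRing_def to_S_bar_eq)

lemma finsum_S_bar: "finite F \<Longrightarrow> finsum (S_bar H) (\<lambda>j. to_S_bar H (h j)) F = to_S_bar H (sum h F)"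
proof (induction F rule: finite_induct)
  interpret cring "S_bar H" by (rule cring_S_bar)
  case empty
  show ?case by (simp add: S_bar_zero)
next
  interpret cring "S_bar H" by (rule cring_S_bar)
  case (insert x F)
  then show ?case by (subst finsum_insert) auto
qed

lemma finprod_S_bar: "finite F \<Longrightarrow> finprod (S_bar H) (\<lambda>j. to_S_bar H (h j)) F = to_S_bar H (prod h F)"
proof (induction F rule: finite_induct)
  interpret cring "S_bar H" by (rule cring_S_bar)
  case empty
  show ?case by simp
next
  interpret cring "S_bar H" by (rule cring_S_bar)
  case (insert x F)
  then show ?case by (subst finprod_insert) auto
qed

text \<open>Eliminated forms do not involve \<open>X i\<close>, so a vector may be moved along
  \<open>axis i 1\<close> into the kernel of \<open>a\<close>, where a form and its eliminated
  version agree. Equal traces thus become equal kernels.\<close>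

lemma proportional_on_hyperplane:
  fixes a :: "'k::field ^ 'n::finite"
  assumes i: "a$i \<noteq> 0" and eq: "form_kernel a \<inter> form_kernel c = form_kernel a \<inter> form_kernel c'"
  shows "\<exists>t. t \<noteq> 0 \<and> elimv a i c = t *s elimv a i c'"
proof (rule form_kernel_eqD)
  let ?p = "\<lambda>x y :: 'k ^ 'n. \<Sum>k\<in>UNIV. x$k * y$k"
  have lin: "?p x (v + s *s axis i 1) = ?p x v + s * x$i" "?p (x - s *s y) v = ?p x v - s * ?p y v" for x y v s
    by (simp_all add: algebra_simps sum.distrib sum_subtractf sum_distrib_left axis_def
      if_distrib[of "(*) _"] cong: if_cong)
  have "v \<in> form_kernel (elimv a i d) \<longleftrightarrow> v + (- ?p a v / a$i) *s axis i 1 \<in> form_kernel a \<inter> form_kernel d" for v d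
  proof -
    define v' where "v' = v + (- ?p a v / a$i) *s axis i 1"
    have av: "?p a v' = 0" unfolding v'_def lin using i by simp
    have "?p (elimv a i d) v = ?p (elimv a i d) v'" unfolding v'_def lin using i by simp
    also have "\<dots> = ?p d v'" unfolding elimv_def lin av by simp
    finally show ?thesis using av unfolding v'_def[symmetric] by (simp add: form_kernel_def)
  qed
  then show "form_kernel (elimv a i c) = form_kernel (elimv a i c')" using eq by blast
qed

lemma form_kernel_elimv: "v \<in> form_kernel a \<Longrightarrow> v \<in> form_kernel (elimv a i c) \<longleftrightarrow> v \<in> form_kernel c"
proof -
  have "(\<Sum>k\<in>UNIV. elimv a i c $ k * v$k) =
      (\<Sum>k\<in>UNIV. c$k * v$k) - (c$i / a$i) * (\<Sum>k\<in>UNIV. a$k * v$k)"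
    by (simp add: elimv_def algebra_simps sum_subtractf sum_distrib_left)
  then show "v \<in> form_kernel a \<Longrightarrow> v \<in> form_kernel (elimv a i c) \<longleftrightarrow> v \<in> form_kernel c"
    by (simp add: form_kernel_def)
qed


lemma to_S_bar_eq_iff_elim:
  "normal_in UNIV H $ i \<noteq> 0 \<Longrightarrow>
    to_S_bar H f = to_S_bar H g \<longleftrightarrow> elim (normal_in UNIV H) i f = elim (normal_in UNIV H) i g"
  by (simp add: to_S_bar_eq_iff H_ideal_iff defining_form_eq elim_eq_iff)

lemma PIdl_S_bar_iff:
  assumes i: "normal_in UNIV H $ i \<noteq> 0"
  shows "to_S_bar H y \<in> PIdl\<^bsub>S_bar H\<^esub> (to_S_bar H q) \<longleftrightarrow>
    elim (normal_in UNIV H) i q dvd elim (normal_in UNIV H) i y"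
proof -
  let ?e = "elim (normal_in UNIV H) i"
  have "to_S_bar H y \<in> PIdl\<^bsub>S_bar H\<^esub> (to_S_bar H q) \<longleftrightarrow>
      (\<exists>s. to_S_bar H y = to_S_bar H s \<otimes>\<^bsub>S_bar H\<^esub> to_S_bar H q)"
    unfolding cgenideal_def carrier_S_bar by blast
  also have "\<dots> \<longleftrightarrow> (\<exists>s. ?e y = ?e s * ?e q)"
    by (simp add: to_S_bar_eq_iff_elim[OF i])
  also have "\<dots> \<longleftrightarrow> ?e q dvd ?e y"
  proof
    assume "?e q dvd ?e y"
    then obtain s where "?e y = ?e q * s" by (auto elim: dvdE)
    \<comment> \<open>The cofactor \<open>s\<close> need not be eliminated itself; a second
      elimination leaves the other terms unchanged.\<close>
    then have "?e (?e y) = ?e (?e q * s)" by (rule arg_cong)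
    then have "?e y = ?e s * ?e q" by (simp add: elim_idem[where a = "normal_in UNIV H", OF i] mult.commute)
    then show "\<exists>s. ?e y = ?e s * ?e q" by blast
  qed (auto simp: dvd_def mult.commute)
  finally show ?thesis .
qed

text \<open>Any lifts of the values on the variables are the coefficients of a derivation of S, and
  this derivation induces \<open>\<eta>\<close> because both agree on generators.\<close>

lemma S_bar_derivation_lift:
  assumes "\<eta> \<in> derivations (S_bar H) (\<lambda>c. to_S_bar H (const c))"
  shows "\<exists>g. \<forall>f. \<eta> (to_S_bar H f) = to_S_bar H (derivation_of g f)"
proof -
  have add: "\<eta> (to_S_bar H (f + g)) = \<eta> (to_S_bar H f) \<oplus>\<^bsub>S_bar H\<^esub> \<eta> (to_S_bar H g)"
    and scale: "\<eta> (to_S_bar H (const c * f)) = to_S_bar H (const c) \<otimes>\<^bsub>S_bar H\<^esub> \<eta> (to_S_bar H f)"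
    and mult: "\<eta> (to_S_bar H (f * g)) =
      to_S_bar H f \<otimes>\<^bsub>S_bar H\<^esub> \<eta> (to_S_bar H g) \<oplus>\<^bsub>S_bar H\<^esub> to_S_bar H g \<otimes>\<^bsub>S_bar H\<^esub> \<eta> (to_S_bar H f)"
    and closed: "\<eta> (to_S_bar H f) \<in> carrier (S_bar H)" for f g c
    using assms by (auto simp: derivations_def carrier_S_bar simp flip: S_bar_simps)
  have "\<forall>k. \<exists>h. \<eta> (to_S_bar H (X k)) = to_S_bar H h" using closed by (auto simp: carrier_S_bar)
  then obtain h where h: "\<And>k. \<eta> (to_S_bar H (X k)) = to_S_bar H (h k)" by metis
  obtain e where e: "\<eta> (to_S_bar H 1) = to_S_bar H e" using closed[of 1] by (auto simp: carrier_S_bar)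
  \<comment> \<open>The Leibniz rule at 1 gives \<open>e = e + e\<close> modulo the ideal, so
    \<open>\<eta>\<close> kills 1 and with it all constants.\<close>
  have "to_S_bar H e = to_S_bar H (e + e)" using mult[of 1 1] by (simp add: e)
  then have "to_S_bar H e = to_S_bar H 0" by (simp add: to_S_bar_eq_iff H_ideal_iff)
  then have const: "\<eta> (to_S_bar H (const c)) = to_S_bar H 0" for c
    using scale[of c 1] e by (metis S_bar_simps(3) mult_1_right mult_zero_right)
  have "\<eta> (to_S_bar H f) = to_S_bar H (derivation_of (\<chi> k. h k) f)" for f
    by (induction f rule: mpoly_induct) (simp_all add: add mult const h derivation_of_mult)
  then show ?thesis by blast
qed

lemma restrict_derivation_of:
  assumes "form_poly (normal_in UNIV H) dvd dotp g (normal_in UNIV H)"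
  shows "restrict_derivation H (derivation_of g) (to_S_bar H f) = to_S_bar H (derivation_of g f)"
proof (rule restrict_derivation_coset[OF derivation_of_mem])
  show "derivation_of g ` H_ideal H \<subseteq> H_ideal H"
    using assms by (auto simp: H_ideal_iff defining_form_eq derivation_of_mult derivation_of_form_poly elim!: dvdE)
qed

lemma restrict_derivation_of_mem:
  assumes "form_poly (normal_in UNIV H) dvd dotp g (normal_in UNIV H)"
  shows "restrict_derivation H (derivation_of g) \<in> derivations (S_bar H) (\<lambda>c. to_S_bar H (const c))"
proof -
  have "restrict_derivation H (derivation_of g) \<in> extensional (carrier (S_bar H))"
    by (simp add: restrict_derivation_def)
  then show ?thesis
    by (auto simp: derivations_def PiE_def carrier_S_bar restrict_derivation_of[OF assms] derivation_of_mult)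
qed

text \<open>The coefficient at \<open>i\<close> is recovered from the others and from the value on
  \<open>a\<close>, since \<open>a $ i\<close> is invertible.\<close>

lemma elim_vec_eqI:
  fixes g h :: "('k::field, 'n::finite) mpoly ^ 'n"
  assumes i: "a$i \<noteq> 0" and "\<And>k. k \<noteq> i \<Longrightarrow> elim a i (g$k) = elim a i (h$k)"
    and "elim a i (dotp g a) = elim a i (dotp h a)"
  shows "elim a i (g$k) = elim a i (h$k)"
proof (cases "k = i")
  case True
  have "dotp g a = const (a$i) * g$i + (\<Sum>k\<in>UNIV - {i}. const (a$k) * g$k)" for g
    unfolding dotp_def by (rule sum.remove) auto
  moreover have "elim a i (\<Sum>k\<in>UNIV - {i}. const (a$k) * g$k) = elim a i (\<Sum>k\<in>UNIV - {i}. const (a$k) * h$k)"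
    unfolding elim_simps by (rule sum.cong) (use assms(2) in auto)
  ultimately have "const (a$i) * elim a i (g$i) = const (a$i) * elim a i (h$i)"
    using assms(3) by simp
  then show ?thesis using True i by (simp add: mpoly_mult_cancel)
qed (rule assms(2))

lemma elim_derivation_of_cong:
  assumes "\<And>k. elim a i (g$k) = elim a i (h$k)"
  shows "elim a i (derivation_of g f) = elim a i (derivation_of h f)"
  by (simp add: derivation_of_def assms)

section \<open>Logarithmic derivations of the restriction\<close>

locale arrangement_restriction =
  fixes A :: "('k::field ^ 'n::finite) set set" and H :: "('k ^ 'n) set" and i :: 'n
  assumes A: "arrangement A" and H: "H \<in> A" and i: "normal_in UNIV H $ i \<noteq> 0"
begin

abbreviation "\<alpha> \<equiv> normal_in UNIV H"
abbreviation "\<beta> x \<equiv> elimv \<alpha> i (normal_in H x)"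

lemma kernel: "K \<in> A \<Longrightarrow> form_kernel (normal_in UNIV K) = K"
  by (rule arrangement_form_kernel[OF A])

lemma kernel_restriction:
  assumes "K \<in> A"
  shows "H \<inter> form_kernel (normal_in H (K \<inter> H)) = K \<inter> H"
  using form_kernel_normal_in[of H "normal_in UNIV K" "K \<inter> H"] kernel[OF assms] by blast

lemma elimv_normal:
  assumes "K \<in> A"
  shows "\<exists>t. t \<noteq> 0 \<and> elimv \<alpha> i (normal_in UNIV K) = t *s \<beta> (K \<inter> H)"
  using proportional_on_hyperplane[OF i] kernel_restriction[OF assms] kernel[OF assms] kernel[OF H]
  by (metis inf_commute)

text \<open>A vanishing \<open>\<beta> x\<close> would make the form of some other hyperplane
  proportional to \<alpha>; distinctness is read off from the traces on \<open>H\<close>, which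
  elimination preserves.\<close>

lemma pairwise_nonproportional_restriction: "pairwise_nonproportional \<beta> (restriction A H)"
proof -
  note np = arrangement_pairwise_nonproportional[OF A]
  have nz: "\<beta> x \<noteq> 0" if x: "x \<in> restriction A H" for x
  proof
    assume "\<beta> x = 0"
    moreover obtain K where K: "K \<in> A" "K \<noteq> H" "x = K \<inter> H" using x by (auto simp: restriction_def)
    ultimately have "elimv \<alpha> i (normal_in UNIV K) = 0" using elimv_normal[OF K(1)] by auto
    then show False using np K H by (auto simp: elimv_def pairwise_nonproportional_def)
  qed
  have kernel: "H \<inter> form_kernel (\<beta> x) = x" if x: "x \<in> restriction A H" for x
  proof -
    obtain K where K: "K \<in> A" "x = K \<inter> H" using x by (auto simp: restriction_def)
    show ?thesis
      using kernel_restriction[OF K(1)] form_kernel_elimv[of _ \<alpha> i "normal_in H x"] kernel[OF H] K by blast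
  qed
  have "\<beta> y \<noteq> t *s \<beta> x" if "x \<in> restriction A H" "y \<in> restriction A H" "x \<noteq> y" for x y t
  proof
    assume eq: "\<beta> y = t *s \<beta> x"
    then have "t \<noteq> 0" using nz[OF that(2)] by auto
    then have "y = x" using kernel[OF that(1)] kernel[OF that(2)] eq form_kernel_smult by metis
    then show False using that by simp
  qed
  then show ?thesis using nz by (simp add: pairwise_nonproportional_def)
qed

lemma restricted_forms:
  obtains t where "restricted_forms (normal_in UNIV) H (A - {H}) i \<beta> (restriction A H) (\<lambda>K. K \<inter> H) t"
proof -
  have "\<forall>K\<in>A. \<exists>t. t \<noteq> 0 \<and> elimv \<alpha> i (normal_in UNIV K) = t *s \<beta> (K \<inter> H)"
    using elimv_normal by blast
  then obtain t where t: "\<And>K. K \<in> A \<Longrightarrow> t K \<noteq> 0"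
      "\<And>K. K \<in> A \<Longrightarrow> elimv \<alpha> i (normal_in UNIV K) = t K *s \<beta> (K \<inter> H)"
    by metis
  have "restricted_forms (normal_in UNIV) H (A - {H}) i \<beta> (restriction A H) (\<lambda>K. K \<inter> H) t"
  proof
    show "finite (A - {H})" using A by (simp add: arrangement_def)
    show "pairwise_nonproportional (normal_in UNIV) (insert H (A - {H}))"
      using arrangement_pairwise_nonproportional[OF A] H by (simp add: insert_absorb)
  qed (use t i pairwise_nonproportional_restriction in \<open>auto simp: restriction_def\<close>)
  then show ?thesis by (rule that)
qed

lemma finite_restriction: "finite (restriction A H)"
  using A by (simp add: restriction_def arrangement_def)

lemma Q_in_restriction:
  "Q_in H (restriction A H) = to_S_bar H (\<Prod>x\<in>restriction A H. form_poly (normal_in H x))"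
  unfolding Q_in_def defining_form_eq by (rule finprod_S_bar[OF finite_restriction])

lemma Q_in_closed: "Q_in H (restriction A H) \<in> carrier (S_bar H)"
  by (simp add: Q_in_restriction)

lemma lift_mem_iff:
  assumes "\<And>f. \<eta> (to_S_bar H f) = to_S_bar H (derivation_of g f)"
  shows "\<eta> (Q_in H (restriction A H)) \<in> PIdl\<^bsub>S_bar H\<^esub> (Q_in H (restriction A H)) \<longleftrightarrow>
    (\<forall>x\<in>restriction A H. form_poly (\<beta> x) dvd elim \<alpha> i (dotp g (normal_in H x)))"
  unfolding Q_in_restriction assms PIdl_S_bar_iff[where H = H, OF i]
  using prod_dvd_logarithmic_sum_iff[OF finite_restriction
      pairwise_nonproportional_prime[OF pairwise_nonproportional_restriction],
      where h = "\<lambda>x. elim \<alpha> i (dotp g (normal_in H x))"]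
  by (simp add: derivation_of_prod[OF finite_restriction] derivation_of_form_poly)

lemma elim_dotp_normal:
  assumes "elim \<alpha> i (dotp g \<alpha>) = 0"
  shows "elim \<alpha> i (dotp g (normal_in H x)) = elim \<alpha> i (dotp g (\<beta> x))"
  using assms by (simp add: elimv_def)

text \<open>As the value on \<alpha> vanishes modulo \<alpha>, the values on the form of
  \<open>K\<close> and on the form of \<open>K \<inter> H\<close> agree modulo \<alpha> up to a
  non-zero scalar.\<close>

lemma restrict_derivation_mem:
  assumes g: "g \<in> log_vectors (normal_in UNIV) A"
  shows "restrict_derivation H (derivation_of g) \<in> carrier (D_module_in H (restriction A H))"
proof -
  have \<alpha>: "form_poly \<alpha> dvd dotp g \<alpha>" using g H by (simp add: log_vectors_def)
  then have 0: "elim \<alpha> i (dotp g \<alpha>) = 0" using elim_eq_0_iff[where a = \<alpha>, OF i] by simp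
  have "form_poly (\<beta> x) dvd elim \<alpha> i (dotp g (normal_in H x))" if x: "x \<in> restriction A H" for x
  proof -
    obtain K where K: "K \<in> A" "x = K \<inter> H" using x by (auto simp: restriction_def)
    obtain t where t: "t \<noteq> 0" "elimv \<alpha> i (normal_in UNIV K) = t *s \<beta> x"
      using elimv_normal[OF K(1)] K(2) by blast
    have "elim \<alpha> i (form_poly (normal_in UNIV K)) dvd elim \<alpha> i (dotp g (normal_in UNIV K))"
      using g K by (intro elim_dvd) (simp add: log_vectors_def)
    then have "form_poly (\<beta> x) dvd elim \<alpha> i (dotp g (normal_in UNIV K))"
      unfolding elim_form t(2) form_poly_simps by (rule dvd_mult_right)
    also have "elim \<alpha> i (dotp g (normal_in UNIV K)) = elim \<alpha> i (dotp g (elimv \<alpha> i (normal_in UNIV K)))"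
      using 0 by (simp add: elimv_def)
    also have "\<dots> = const t * elim \<alpha> i (dotp g (normal_in H x))"
      unfolding t(2) elim_dotp_normal[OF 0] by simp
    finally have "form_poly (\<beta> x) dvd const (inverse t) * (const t * elim \<alpha> i (dotp g (normal_in H x)))"
      by (rule dvd_mult)
    then show ?thesis by (simp only: mult.assoc[symmetric] const_inverse[OF t(1)] mult_1_left)
  qed
  then show ?thesis
    using restrict_derivation_of_mem[OF \<alpha>] lift_mem_iff[OF restrict_derivation_of[OF \<alpha>]]
    by (simp add: D_module_in_def log_derivations_def)
qed

text \<open>The lift is automatically tangent to \<open>H\<close>: \<open>\<eta>\<close> sends the
  class of \<alpha>, which is 0, to 0.\<close>

lemma D_module_in_lift:
  assumes "\<eta> \<in> carrier (D_module_in H (restriction A H))"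
  obtains g where "\<And>f. \<eta> (to_S_bar H f) = to_S_bar H (derivation_of g f)"
    "elim \<alpha> i (dotp g \<alpha>) = 0"
    "\<And>x. x \<in> restriction A H \<Longrightarrow> form_poly (\<beta> x) dvd elim \<alpha> i (dotp g (\<beta> x))"
proof -
  have \<eta>: "\<eta> \<in> derivations (S_bar H) (\<lambda>c. to_S_bar H (const c))"
      "\<eta> (Q_in H (restriction A H)) \<in> PIdl\<^bsub>S_bar H\<^esub> (Q_in H (restriction A H))"
    using assms by (auto simp: D_module_in_def log_derivations_def)
  obtain g where g: "\<And>f. \<eta> (to_S_bar H f) = to_S_bar H (derivation_of g f)"
    using S_bar_derivation_lift[OF \<eta>(1)] by blast
  have "to_S_bar H (form_poly \<alpha>) = to_S_bar H 0"
    by (simp add: to_S_bar_eq_iff H_ideal_iff defining_form_eq)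
  then have "to_S_bar H (dotp g \<alpha>) = to_S_bar H 0"
    using g[of "form_poly \<alpha>"] g[of 0] by (simp add: derivation_of_form_poly)
  then have 0: "elim \<alpha> i (dotp g \<alpha>) = 0" using to_S_bar_eq_iff_elim[where H = H, OF i] by simp
  show ?thesis using that[OF g 0] lift_mem_iff[OF g] \<eta>(2) elim_dotp_normal[OF 0] by simp
qed

lemma finsum_restrict_apply:
  assumes F: "finite F" and g: "\<And>j. j \<in> F \<Longrightarrow> g j \<in> log_vectors (normal_in UNIV) A"
    and \<psi>: "\<And>j. j \<in> F \<Longrightarrow> \<psi> j = restrict_derivation H (derivation_of (g j))"
    and c: "\<And>j. j \<in> F \<Longrightarrow> c j = to_S_bar H (c' j)"
  shows "(\<Oplus>\<^bsub>D_module_in H (restriction A H)\<^esub>j\<in>F. c j \<odot>\<^bsub>D_module_in H (restriction A H)\<^esub> \<psi> j) (to_S_bar H f) =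
      to_S_bar H (derivation_of (\<Sum>j\<in>F. c' j *s g j) f)"
    and "(\<Oplus>\<^bsub>D_module_in H (restriction A H)\<^esub>j\<in>F. c j \<odot>\<^bsub>D_module_in H (restriction A H)\<^esub> \<psi> j)
      \<in> carrier (D_module_in H (restriction A H))"
proof -
  interpret cring "S_bar H" by (rule cring_S_bar)
  have mem: "\<psi> \<in> F \<rightarrow> carrier (D_module_in H (restriction A H))" and carr: "c \<in> F \<rightarrow> carrier (S_bar H)"
    using restrict_derivation_mem g \<psi> c by auto
  have "(\<Oplus>\<^bsub>D_module_in H (restriction A H)\<^esub>j\<in>F. c j \<odot>\<^bsub>D_module_in H (restriction A H)\<^esub> \<psi> j) (to_S_bar H f) =
      (\<Oplus>\<^bsub>S_bar H\<^esub>j\<in>F. c j \<otimes>\<^bsub>S_bar H\<^esub> \<psi> j (to_S_bar H f))"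
    using mem carr Q_in_closed unfolding D_module_in_def
    by (intro log_derivations_finsum_apply F) auto
  also have "\<dots> = (\<Oplus>\<^bsub>S_bar H\<^esub>j\<in>F. to_S_bar H (c' j * derivation_of (g j) f))"
  proof (rule finsum_cong')
    fix j assume j: "j \<in> F"
    then have "form_poly \<alpha> dvd dotp (g j) \<alpha>" using g H by (simp add: log_vectors_def)
    then show "c j \<otimes>\<^bsub>S_bar H\<^esub> \<psi> j (to_S_bar H f) = to_S_bar H (c' j * derivation_of (g j) f)"
      using j by (simp add: \<psi> c restrict_derivation_of)
  qed auto
  also have "\<dots> = to_S_bar H (derivation_of (\<Sum>j\<in>F. c' j *s g j) f)"
    unfolding derivation_of_combination by (rule finsum_S_bar[OF F])
  finally show "(\<Oplus>\<^bsub>D_module_in H (restriction A H)\<^esub>j\<in>F. c j \<odot>\<^bsub>D_module_in H (restriction A H)\<^esub> \<psi> j) (to_S_bar H f) =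
      to_S_bar H (derivation_of (\<Sum>j\<in>F. c' j *s g j) f)" .
  show "(\<Oplus>\<^bsub>D_module_in H (restriction A H)\<^esub>j\<in>F. c j \<odot>\<^bsub>D_module_in H (restriction A H)\<^esub> \<psi> j)
      \<in> carrier (D_module_in H (restriction A H))"
    using mem carr Q_in_closed unfolding D_module_in_def
    by (intro log_derivations_finsum_closed) auto
qed

lemma D_module_in_eqI:
  assumes "\<eta> \<in> carrier (D_module_in H (restriction A H))" "\<zeta> \<in> carrier (D_module_in H (restriction A H))"
    and "\<And>f. \<eta> (to_S_bar H f) = \<zeta> (to_S_bar H f)"
  shows "\<eta> = \<zeta>"
proof (rule extensionalityI)
  show "\<eta> \<in> extensional (carrier (S_bar H))" "\<zeta> \<in> extensional (carrier (S_bar H))"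
    using assms(1,2) by (auto simp: D_module_in_def log_derivations_def derivations_def PiE_def)
qed (use assms(3) in \<open>auto simp: carrier_S_bar\<close>)

end


theorem theorem2p9:
  fixes A :: "('k::field ^ 'n::finite) set set"
    and H :: "('k ^ 'n) set"
    and d :: "nat \<Rightarrow> nat"
    and \<phi> :: "nat \<Rightarrow> ('k, 'n) mpoly \<Rightarrow> ('k, 'n) mpoly"
  assumes "arrangement A" and "A \<noteq> {}"
    and "free_arrangement A"
    and "exponents A = image_mset d (mset_set {1..CARD('n)})"
    and "mono_on {1..CARD('n)} d"
    and "H \<in> A"
    and "free_arrangement (A - {H})"
    and "module_basis S_ring (D_module A) \<phi> {1..CARD('n)}"
    and "\<And>j. j \<in> {1..CARD('n)} \<Longrightarrow> homogeneous_derivation (d j) (\<phi> j)"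
  shows "\<exists>p\<in>{1..CARD('n)}.
    module_basis (S_bar H) (D_module_in H (restriction A H))
      (\<lambda>j. restrict_derivation H (\<phi> j)) ({1..CARD('n)} - {p})"
proof -
  have A: "arrangement A" and HA: "H \<in> A" by fact+
  let ?n = "normal_in UNIV :: ('k ^ 'n) set \<Rightarrow> 'k ^ 'n"
  have A': "arrangement (A - {H})" using A by (auto simp: arrangement_def)
  have "?n H \<noteq> 0"
    using arrangement_pairwise_nonproportional[OF A] HA by (simp add: pairwise_nonproportional_def)
  then obtain i where i: "?n H $ i \<noteq> 0" by (auto simp: vec_eq_iff)
  interpret arrangement_restriction A H i by unfold_locales (fact A HA i)+
  obtain t where t: "restricted_forms ?n H (A - {H}) i \<beta> (restriction A H) (\<lambda>K. K \<inter> H) t"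
    by (rule restricted_forms)
  interpret restricted_forms ?n H "A - {H}" i \<beta> "restriction A H" "\<lambda>K. K \<inter> H" t by (rule t)
  have insertA: "insert H (A - {H}) = A" using HA by blast
  obtain \<kappa> :: "'n \<Rightarrow> nat" and P where \<kappa>: "bij_betw \<kappa> UNIV {1..CARD('n)}"
    and \<phi>P: "\<forall>r. \<phi> (\<kappa> r) = derivation_of (P$r) \<and> P$r \<in> log_vectors ?n A"
    and spanP: "\<forall>h\<in>log_vectors ?n A. \<exists>c. h = (\<Sum>r\<in>UNIV. c r *s P$r)"
    using D_module_basis_matrix[OF A assms(8)] by (elim exE conjE) (rule that)
  have \<phi>: "\<phi> (\<kappa> r) = derivation_of (P$r)" and P: "P$r \<in> log_vectors ?n A" for r
    using \<phi>P by simp_all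
  obtain B where B: "module_basis S_ring (D_module (A - {H})) (\<lambda>b. b) B"
    using assms(7) by (auto simp: free_arrangement_def free_module_def)
  obtain \<kappa>' :: "'n \<Rightarrow> ('k, 'n) mpoly \<Rightarrow> ('k, 'n) mpoly" and T where "bij_betw \<kappa>' UNIV B"
    and T: "\<forall>r. \<kappa>' r = derivation_of (T$r) \<and> T$r \<in> log_vectors ?n (A - {H})"
    and spanT: "\<forall>h\<in>log_vectors ?n (A - {H}). \<exists>c. h = (\<Sum>r\<in>UNIV. c r *s T$r)"
    using D_module_basis_matrix[OF A' B] by (elim exE conjE) (rule that)
  have hom: "homogeneous (d (\<kappa> r)) (P$r$k)" for r k
  proof -
    have "\<kappa> r \<in> {1..CARD('n)}" using \<kappa> by (auto simp: bij_betw_def)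
    then obtain f where f: "\<phi> (\<kappa> r) = (\<lambda>g. \<Sum>i\<in>UNIV. f i * partial i g)" "\<And>i. homogeneous (d (\<kappa> r)) (f i)"
      using assms(9) unfolding homogeneous_derivation_def by blast
    have "P$r$k = f k"
      using fun_cong[OF f(1), of "X k"] by (simp add: \<phi> partial_X if_distrib[of "(*) _"] cong: if_cong)
    then show ?thesis using f(2) by simp
  qed
  \<comment> \<open>Rows are indexed by the type of the variables, so the member of the given basis
    to be dropped is \<open>\<phi> (\<kappa> p)\<close>.\<close>
  obtain p where span: "\<forall>h\<in>log_vectors \<beta> (restriction A H). h$i = 0 \<longrightarrow>
        (\<exists>c. h = (\<Sum>r\<in>UNIV - {p}. c r *s bar_matrix p P $ r))"
    and indep: "\<forall>c. (\<Sum>r\<in>UNIV - {p}. c r *s bar_matrix p P $ r) = 0 \<longrightarrow> (\<forall>r\<in>UNIV - {p}. c r = 0)"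
    by (rule exE[OF exists_bar_basis[of P "\<lambda>r. d (\<kappa> r)" T, unfolded insertA,
          OF P spanP[rule_format] hom conjunct2[OF spec[OF T]] spanT[rule_format]]],
        assumption, assumption, elim conjE, rule that)
  let ?M = "D_module_in H (restriction A H)" and ?J = "{1..CARD('n)} - {\<kappa> p}"
  let ?\<psi> = "\<lambda>j. restrict_derivation H (\<phi> j)"
  define \<iota> where "\<iota> = inv_into UNIV \<kappa>"
  have \<iota>\<kappa>: "\<iota> (\<kappa> r) = r" for r using \<kappa> by (simp add: \<iota>_def bij_betw_def)
  have \<kappa>\<iota>: "\<kappa> (\<iota> j) = j" if "j \<in> {1..CARD('n)}" for j
    using \<kappa> that by (metis \<iota>_def bij_betw_def f_inv_into_f)
  have \<kappa>J: "bij_betw \<kappa> (UNIV - {p}) ?J"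
    using \<kappa> by (auto simp: bij_betw_def image_set_diff intro: inj_on_subset)
  have \<psi>: "?\<psi> j = restrict_derivation H (derivation_of (P $ \<iota> j))" if "j \<in> ?J" for j
    using \<phi>[of "\<iota> j"] \<kappa>\<iota>[of j] that by simp
  have dotpP: "elim \<alpha> i (dotp (P$r) \<alpha>) = 0" for r
    using P[of r] HA elim_eq_0_iff[of \<alpha> i, OF i] by (simp add: log_vectors_def)
  have "module_basis (S_bar H) ?M ?\<psi> ?J"
    unfolding module_basis_def
  proof (intro conjI ballI allI impI)
    show "?\<psi> \<in> ?J \<rightarrow> carrier ?M" using \<psi> restrict_derivation_mem P by auto
  next
    fix \<eta> assume \<eta>: "\<eta> \<in> carrier ?M"
    obtain g where g: "\<And>f. \<eta> (to_S_bar H f) = to_S_bar H (derivation_of g f)"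
      and g\<alpha>: "elim \<alpha> i (dotp g \<alpha>) = 0"
      and g\<beta>: "\<And>x. x \<in> restriction A H \<Longrightarrow> form_poly (\<beta> x) dvd elim \<alpha> i (dotp g (\<beta> x))"
      using D_module_in_lift[OF \<eta>] by blast
    \<comment> \<open>The coordinates of \<open>\<eta>\<close> on \<open>H\<close>: eliminated
      representatives, with 0 in the place of the eliminated variable.\<close>
    define h where "h = (\<chi> k. if k = i then 0 else elim \<alpha> i (g$k))"
    have "dotp h (\<beta> x) = elim \<alpha> i (dotp g (\<beta> x))" for x
      using i by (auto simp: dotp_def h_def intro!: sum.cong)
    then have "h \<in> log_vectors \<beta> (restriction A H)" using g\<beta> by (simp add: log_vectors_def)
    from bspec[OF span this] obtain c where c: "h = (\<Sum>r\<in>UNIV - {p}. c r *s bar_matrix p P $ r)"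
      by (auto simp: h_def)
    let ?g = "\<Sum>j\<in>?J. c (\<iota> j) *s P $ \<iota> j"
    have g_eq: "?g = (\<Sum>r\<in>UNIV - {p}. c r *s P$r)"
      using sum.reindex_bij_betw[OF \<kappa>J, of "\<lambda>j. c (\<iota> j) *s P $ \<iota> j"] by (simp add: \<iota>\<kappa>)
    \<comment> \<open>The coefficients found for \<open>h\<close> also serve for \<open>g\<close>:
      away from \<open>i\<close> this is the relation for \<open>h\<close>, and at \<open>i\<close>
      it follows because both vectors have value 0 on \<alpha> modulo \<alpha>.\<close>
    have "elim \<alpha> i (g$k) = elim \<alpha> i (?g$k)" for k
    proof (rule elim_vec_eqI[where a = \<alpha>, OF i])
      show "elim \<alpha> i (dotp g \<alpha>) = elim \<alpha> i (dotp ?g \<alpha>)" unfolding g_eq by (simp add: g\<alpha> dotpP)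
      fix k assume k: "k \<noteq> i"
      then have "elim \<alpha> i (g$k) = (\<Sum>r\<in>UNIV - {p}. c r * elim \<alpha> i (P$r$k))"
        using arg_cong[OF c, of "\<lambda>v. v$k"] by (simp add: h_def bar_matrix_def)
      \<comment> \<open>The coefficients \<open>c r\<close> need not be eliminated; a second
        elimination reduces them and fixes everything else.\<close>
      then have "elim \<alpha> i (elim \<alpha> i (g$k)) = elim \<alpha> i (\<Sum>r\<in>UNIV - {p}. c r * elim \<alpha> i (P$r$k))"
        by (rule arg_cong)
      then show "elim \<alpha> i (g$k) = elim \<alpha> i (?g$k)"
        unfolding g_eq by (simp add: elim_idem[where a = \<alpha>, OF i])
    qed
    then have eq: "to_S_bar H (derivation_of g f) = to_S_bar H (derivation_of ?g f)" for f
      using elim_derivation_of_cong to_S_bar_eq_iff_elim[of H i, OF i] by blast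
    let ?c = "\<lambda>j. to_S_bar H (c (\<iota> j))"
    have "\<eta> = (\<Oplus>\<^bsub>?M\<^esub>j\<in>?J. ?c j \<odot>\<^bsub>?M\<^esub> ?\<psi> j)"
    proof (rule D_module_in_eqI[OF \<eta>])
      show "(\<Oplus>\<^bsub>?M\<^esub>j\<in>?J. ?c j \<odot>\<^bsub>?M\<^esub> ?\<psi> j) \<in> carrier ?M"
        by (rule finsum_restrict_apply(2)[OF _ _ \<psi>]) (auto simp: P)
      fix f show "\<eta> (to_S_bar H f) = (\<Oplus>\<^bsub>?M\<^esub>j\<in>?J. ?c j \<odot>\<^bsub>?M\<^esub> ?\<psi> j) (to_S_bar H f)"
        unfolding g eq by (rule finsum_restrict_apply(1)[OF _ _ \<psi>, symmetric]) (auto simp: P)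
    qed
    then show "\<exists>F c. finite F \<and> F \<subseteq> ?J \<and> c \<in> F \<rightarrow> carrier (S_bar H) \<and>
        \<eta> = (\<Oplus>\<^bsub>?M\<^esub>j\<in>F. c j \<odot>\<^bsub>?M\<^esub> ?\<psi> j)"
      by (intro exI[of _ ?J] exI[of _ ?c]) auto
  next
    fix F c j
    assume asm: "finite F \<and> F \<subseteq> ?J \<and> c \<in> F \<rightarrow> carrier (S_bar H) \<and>
        (\<Oplus>\<^bsub>?M\<^esub>j\<in>F. c j \<odot>\<^bsub>?M\<^esub> ?\<psi> j) = \<zero>\<^bsub>?M\<^esub>" and j: "j \<in> F"
    then have F: "finite F" "F \<subseteq> ?J" by auto
    have "\<forall>j\<in>F. \<exists>e. c j = to_S_bar H e" using asm unfolding carrier_S_bar by blast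
    then obtain e where e: "\<And>j. j \<in> F \<Longrightarrow> c j = to_S_bar H (e j)" by metis
    \<comment> \<open>Representatives of the coefficients, eliminated and extended by 0 outside
      \<open>F\<close> to match the full sum in \<open>indep\<close>.\<close>
    let ?e = "\<lambda>r. if \<kappa> r \<in> F then elim \<alpha> i (e (\<kappa> r)) else 0"
    have "to_S_bar H (derivation_of (\<Sum>j\<in>F. e j *s P $ \<iota> j) f) = to_S_bar H 0" for f
    proof -
      have "to_S_bar H (derivation_of (\<Sum>j\<in>F. e j *s P $ \<iota> j) f) = \<zero>\<^bsub>?M\<^esub> (to_S_bar H f)"
        using finsum_restrict_apply(1)[OF F(1), of "\<lambda>j. P $ \<iota> j" ?\<psi> c e f] P \<psi> subsetD[OF F(2)] e asm
        by (simp only:)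
      then show ?thesis by (simp add: D_module_in_def log_derivations_def S_bar_zero)
    qed
    \<comment> \<open>Evaluating the vanishing derivation on the variables yields its
      coefficients.\<close>
    from this[of "X _"] have "elim \<alpha> i (\<Sum>j\<in>F. e j * P $ \<iota> j $ k) = 0" for k
      using to_S_bar_eq_iff_elim[of H i _ 0, OF i] by simp
    then have 0: "(\<Sum>j\<in>F. elim \<alpha> i (e j) * elim \<alpha> i (P $ \<iota> j $ k)) = 0" for k by simp
    have reindex: "(\<Sum>r\<in>UNIV - {p}. ?e r * elim \<alpha> i (P$r$k)) = 0" for k
    proof -
      have "(\<Sum>r\<in>UNIV - {p}. ?e r * elim \<alpha> i (P$r$k)) =
          (\<Sum>j\<in>?J. (if j \<in> F then elim \<alpha> i (e j) else 0) * elim \<alpha> i (P $ \<iota> j $ k))"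
        using sum.reindex_bij_betw[OF \<kappa>J, of "\<lambda>j. (if j \<in> F then elim \<alpha> i (e j) else 0) * elim \<alpha> i (P $ \<iota> j $ k)"]
        by (simp only: \<iota>\<kappa>)
      also have "\<dots> = (\<Sum>j\<in>F. elim \<alpha> i (e j) * elim \<alpha> i (P $ \<iota> j $ k))"
        using F by (intro sum.mono_neutral_cong_right) auto
      finally show ?thesis using 0 by simp
    qed
    have "(\<Sum>r\<in>UNIV - {p}. ?e r *s bar_matrix p P $ r) = 0"
    proof -
      have "(\<Sum>r\<in>UNIV - {p}. ?e r * bar_matrix p P $ r $ k) = 0" for k
      proof (cases "k = i")
        case True
        then show ?thesis by (intro sum.neutral) (auto simp: bar_matrix_def)
      next
        case False
        have "(\<Sum>r\<in>UNIV - {p}. ?e r * bar_matrix p P $ r $ k) = (\<Sum>r\<in>UNIV - {p}. ?e r * elim \<alpha> i (P$r$k))"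
          using False by (intro sum.cong) (auto simp: bar_matrix_def)
        then show ?thesis using reindex by simp
      qed
      then show ?thesis by (simp add: vec_eq_iff)
    qed
    then have "\<forall>r\<in>UNIV - {p}. ?e r = 0" using spec[OF indep, of ?e] by (rule mp[rotated])
    moreover have j': "j \<in> ?J" "\<kappa> (\<iota> j) = j" using j F \<kappa>\<iota> by auto
    then have "\<iota> j \<in> UNIV - {p}" by auto
    ultimately have "?e (\<iota> j) = 0" by (rule bspec)
    then have "elim \<alpha> i (e j) = elim \<alpha> i 0" using j j' by simp
    then show "c j = \<zero>\<^bsub>S_bar H\<^esub>"
      using e[OF j] to_S_bar_eq_iff_elim[of H i "e j" 0, OF i] by (simp add: S_bar_zero)
  qed
  moreover have "\<kappa> p \<in> {1..CARD('n)}" using \<kappa> by (auto simp: bij_betw_def)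
  ultimately show ?thesis by blast
qed

end
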